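(* There is a fair tiling of $\mathbb{R}^2$ by pairwise incongruent convex pentagons. That is, there exists a family of mutually non-overlapping convex pentagons whose union is $\mathbb{R}^2$, such that all pentagons of the family have the same area and the same perimeter, and no two distinct pentagons of the family are congruent.
   Context: A tiling of $\mathbb{R}^2$ is a family of mutually non-overlapping polygons (i.e. with pairwise disjoint interiors) whose union is $\mathbb{R}^2$. The tiling need not be vertex-to-vertex. A tiling is called fair if all its members have the same area and the same perimeter. Congruence is meant with respect to Euclidean isometries of the plane, including reflections. *)

theory Defs
  imports "HOL-Analysis.Analysis"
begin

definition convex_polygon :: "(real^2) set \<Rightarrow> bool" where
  "convex_polygon P \<longleftrightarrow> polytope P \<and> interior P \<noteq> {}"

text \<open>
  Vertices are extreme points, so a point in the relative interior of a side never counts as a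
  vertex, even if it is a corner of a neighbouring tile: every angle of a pentagon is less than
  a straight angle.
\<close>

definition vertices :: "(real^2) set \<Rightarrow> (real^2) set" where
  "vertices P = {v. v extreme_point_of P}"

definition convex_pentagon :: "(real^2) set \<Rightarrow> bool" where
  "convex_pentagon P \<longleftrightarrow> convex_polygon P \<and> card (vertices P) = 5"

abbreviation area :: "(real^2) set \<Rightarrow> real" where
  "area P \<equiv> measure lebesgue P"

text \<open>
  The edges of a convex polygon are its sides, finitely many closed segments; the diameter of
  a segment is its length.
\<close>

definition perimeter :: "(real^2) set \<Rightarrow> real" where
  "perimeter P = (\<Sum>e | e edge_of P. diameter e)"

text \<open>
  Tiles may have any number of vertices here. No vertex-to-vertex condition and no local
  finiteness is imposed.
\<close>

definition tiling :: "(real^2) set set \<Rightarrow> bool" where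
  "tiling T \<longleftrightarrow>
     (\<forall>P\<in>T. convex_polygon P) \<and>
     pairwise (\<lambda>P Q. interior P \<inter> interior Q = {}) T \<and>
     \<Union>T = UNIV"

definition fair :: "(real^2) set set \<Rightarrow> bool" where
  "fair T \<longleftrightarrow> (\<forall>P\<in>T. \<forall>Q\<in>T. area P = area Q \<and> perimeter P = perimeter Q)"

text \<open>
  Every distance-preserving self-map of the plane is a Euclidean isometry (in particular
  surjective); reflections are included.
\<close>

definition congruent_sets :: "(real^2) set \<Rightarrow> (real^2) set \<Rightarrow> bool" where
  "congruent_sets P Q \<longleftrightarrow>
     (\<exists>f :: real^2 \<Rightarrow> real^2. (\<forall>x y. dist (f x) (f y) = dist x y) \<and> f ` P = Q)"

end

theory Submission
  imports Defs
begin

text \<open>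
  The plane is cut into strips of height 22. In every strip a zigzag runs along the centre line; its upper vertices are joined
  by segments (walls) to the top line and its lower vertices to the bottom line, which leaves a row of pentagons above the
  zigzag and one below. For a suitable choice of the slopes all pentagons are congruent with area 176 and sides
  10, 10, 10, 10, 16; the walls are slanted because a half-turn symmetry of the strip would pair up congruent tiles along the
  whole curve below.

  Six consecutive tiles form a block. With the first two and the last two zigzag vertices and walls fixed, a block has twelve
  free parameters, subject to eleven independent conditions (six perimeters, five areas), so there is a curve of fair
  blocks through the congruent one; it is obtained from Brouwer's fixed point theorem. To first order along this curve the sums
  of the squared distances between the vertices of the six tiles change at distinct nonzero rates. Placing the block with
  parameter \<open>\<tau> / 100^n\<close> at the n-th position therefore gives pairwise different sums, and pairwise incongruent tiles.
\<close>

section \<open>Convex pentagons\<close>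

definition orient :: "real^2 \<Rightarrow> real^2 \<Rightarrow> real^2 \<Rightarrow> real" where
  "orient A B C = (B$1 - A$1) * (C$2 - A$2) - (B$2 - A$2) * (C$1 - A$1)"

lemma orient_rotate: "orient A B C = orient B C A"
  by (simp add: orient_def algebra_simps)

lemma orient_swap: "orient B A C = - orient A B C"
  by (simp add: orient_def algebra_simps)

lemma orient_degenerate [simp]: "orient A A B = 0" "orient A B A = 0" "orient A B B = 0"
  by (simp_all add: orient_def)

text \<open>For fixed A and B the orientation is affine in the third point, with a normal of the
  line AB as gradient. This turns facts about half-spaces and hyperplanes into facts about
  \<open>orient\<close>.\<close>

lemma orient_inner:
  "orient A B p = vector [A$2 - B$2, B$1 - A$1] \<bullet> p - vector [A$2 - B$2, B$1 - A$1] \<bullet> A"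
  by (simp add: orient_def inner_vec_def sum_2 algebra_simps)

lemma orient_halfplane:
  "{p. orient A B p \<ge> 0} = {p. vector [A$2 - B$2, B$1 - A$1] \<bullet> p \<ge> vector [A$2 - B$2, B$1 - A$1] \<bullet> A}"
  "{p. orient A B p > 0} = {p. vector [A$2 - B$2, B$1 - A$1] \<bullet> p > vector [A$2 - B$2, B$1 - A$1] \<bullet> A}"
  "{p. orient A B p = 0} = {p. vector [A$2 - B$2, B$1 - A$1] \<bullet> p = vector [A$2 - B$2, B$1 - A$1] \<bullet> A}"
  by (auto simp: orient_inner)

lemma normal_nonzero:
  fixes A B :: "real^2"
  assumes "A \<noteq> B" shows "(vector [A$2 - B$2, B$1 - A$1] :: real^2) \<noteq> 0"
  using assms by (auto simp: vec_eq_iff forall_2)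

lemma convex_orient_ge: "convex {p. orient A B p \<ge> 0}"
  unfolding orient_halfplane by (rule convex_halfspace_ge)

lemma open_orient_gt: "open {p. orient A B p > 0}"
  unfolding orient_halfplane by (rule open_halfspace_gt)

lemma negligible_orient_eq: "A \<noteq> B \<Longrightarrow> negligible {p. orient A B p = 0}"
  unfolding orient_halfplane using normal_nonzero by (intro negligible_hyperplane) blast

lemma interior_orient_ge: "A \<noteq> B \<Longrightarrow> interior {p. orient A B p \<ge> 0} = {p. orient A B p > 0}"
  unfolding orient_halfplane using normal_nonzero by (intro interior_halfspace_ge) blast

text \<open>The interior of a set inside a closed half-plane lies in the open half-plane, and
  opposite open half-planes are disjoint.\<close>

lemma separated_interiors:
  assumes "A \<noteq> B" "\<And>p. p \<in> P \<Longrightarrow> orient A B p \<ge> 0" "\<And>p. p \<in> Q \<Longrightarrow> orient B A p \<ge> 0"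
  shows "interior P \<inter> interior Q = {}"
proof -
  have "interior P \<subseteq> {p. orient A B p > 0}"
    using interior_mono[of P "{p. orient A B p \<ge> 0}"] assms(1,2) interior_orient_ge by blast
  moreover have "interior Q \<subseteq> {p. orient B A p > 0}"
    using interior_mono[of Q "{p. orient B A p \<ge> 0}"] assms(1,3) interior_orient_ge[of B A] by blast
  ultimately show ?thesis
    by (force simp: orient_swap[of B A])
qed

text \<open>The barycentric coordinate of p at a corner is the orientation of p with the opposite
  side, divided by that of the whole triangle.\<close>

lemma triangle_halfplanes:
  assumes D: "orient A B C > 0"
  shows "convex hull {A, B, C} = {p. orient A B p \<ge> 0 \<and> orient B C p \<ge> 0 \<and> orient C A p \<ge> 0}"
    (is "_ = ?R")
proof
  have "?R = {p. orient A B p \<ge> 0} \<inter> {p. orient B C p \<ge> 0} \<inter> {p. orient C A p \<ge> 0}" by auto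
  then have "convex ?R" by (simp add: convex_Int convex_orient_ge)
  moreover have "{A, B, C} \<subseteq> ?R"
    using D orient_rotate[of A B C] orient_rotate[of B C A] by auto
  ultimately show "convex hull {A, B, C} \<subseteq> ?R" by (rule hull_minimal[rotated])
  show "?R \<subseteq> convex hull {A, B, C}"
  proof
    fix p assume p: "p \<in> ?R"
    let ?d = "orient A B C"
    define u where "u = orient B C p / ?d"
    define v where "v = orient C A p / ?d"
    define w where "w = orient A B p / ?d"
    have s: "orient B C p + orient C A p + orient A B p = ?d"
      by (simp add: orient_def algebra_simps)
    have "u + v + w = 1" using D s by (simp add: u_def v_def w_def flip: add_divide_distrib)
    moreover have "u \<ge> 0" "v \<ge> 0" "w \<ge> 0" using p D by (auto simp: u_def v_def w_def)
    moreover have "p = u *\<^sub>R A + v *\<^sub>R B + w *\<^sub>R C"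
    proof -
      have "?d * p$i = orient B C p * A$i + orient C A p * B$i + orient A B p * C$i" if "i = 1 \<or> i = 2" for i
        using that by (auto simp: orient_def algebra_simps)
      then have "p$i = u * A$i + v * B$i + w * C$i" if "i = 1 \<or> i = 2" for i
        using that D unfolding u_def v_def w_def by (simp add: field_simps)
      then show ?thesis by (simp add: vec_eq_iff forall_2)
    qed
    ultimately show "p \<in> convex hull {A, B, C}" unfolding convex_hull_3 by blast
  qed
qed

text \<open>Strictly convex position in counterclockwise order. Left turns at the five corners alone
  would also admit the pentagram, which winds twice; all ten triples exclude it and make the
  condition invariant under cyclic relabelling.\<close>

definition ccw5 :: "real^2 \<Rightarrow> real^2 \<Rightarrow> real^2 \<Rightarrow> real^2 \<Rightarrow> real^2 \<Rightarrow> bool" where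
  "ccw5 A B C D E \<longleftrightarrow>
     orient A B C > 0 \<and> orient A B D > 0 \<and> orient A B E > 0 \<and> orient A C D > 0 \<and> orient A C E > 0 \<and>
     orient A D E > 0 \<and> orient B C D > 0 \<and> orient B C E > 0 \<and> orient B D E > 0 \<and> orient C D E > 0"

lemma ccw5_rotate: "ccw5 A B C D E \<Longrightarrow> ccw5 B C D E A"
  unfolding ccw5_def
  by (metis orient_rotate)

lemma ccw5_pos:
  assumes "ccw5 A B C D E"
  shows
    "orient A B C > 0" "orient B C A > 0" "orient C A B > 0" "orient A B D > 0" "orient B D A > 0" "orient D A B > 0"
    "orient A B E > 0" "orient B E A > 0" "orient E A B > 0" "orient A C D > 0" "orient C D A > 0" "orient D A C > 0"
    "orient A C E > 0" "orient C E A > 0" "orient E A C > 0" "orient A D E > 0" "orient D E A > 0" "orient E A D > 0"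
    "orient B C D > 0" "orient C D B > 0" "orient D B C > 0" "orient B C E > 0" "orient C E B > 0" "orient E B C > 0"
    "orient B D E > 0" "orient D E B > 0" "orient E B D > 0" "orient C D E > 0" "orient D E C > 0" "orient E C D > 0"
  using assms unfolding ccw5_def by (simp_all add: orient_def algebra_simps)

lemma ccw5_distinct: "ccw5 A B C D E \<Longrightarrow> distinct [A, B, C, D, E]"
  unfolding ccw5_def by auto

text \<open>A cycle of inclusions: the hull lies in the five half-planes, their intersection lies in
  the fan of triangles at A (the signs with respect to the diagonals AC and AD select the triangle),
  and the fan lies in the hull.\<close>

lemma pentagon_halfplanes:
  assumes c: "ccw5 A B C D E"
  shows "convex hull {A, B, C, D, E} =
    {p. orient A B p \<ge> 0 \<and> orient B C p \<ge> 0 \<and> orient C D p \<ge> 0 \<and> orient D E p \<ge> 0 \<and> orient E A p \<ge> 0}"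
    (is "_ = ?R")
    and pentagon_fan: "convex hull {A, B, C, D, E} =
      convex hull {A, B, C} \<union> convex hull {A, C, D} \<union> convex hull {A, D, E}"
proof -
  have "?R = {p. orient A B p \<ge> 0} \<inter> {p. orient B C p \<ge> 0} \<inter> {p. orient C D p \<ge> 0}
      \<inter> {p. orient D E p \<ge> 0} \<inter> {p. orient E A p \<ge> 0}" by auto
  then have "convex ?R" by (simp add: convex_Int convex_orient_ge)
  moreover have "{A, B, C, D, E} \<subseteq> ?R"
    using ccw5_pos[OF c] by (simp add: less_imp_le)
  ultimately have 1: "convex hull {A, B, C, D, E} \<subseteq> ?R" by (rule hull_minimal[rotated])
  have 2: "?R \<subseteq> convex hull {A, B, C} \<union> convex hull {A, C, D} \<union> convex hull {A, D, E}"
  proof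
    fix p assume p: "p \<in> ?R"
    show "p \<in> convex hull {A, B, C} \<union> convex hull {A, C, D} \<union> convex hull {A, D, E}"
    proof (cases "orient A C p \<ge> 0")
      case False
      then show ?thesis
        using p orient_swap[of C A p] by (simp add: triangle_halfplanes[OF ccw5_pos(1)[OF c]])
    next
      case True
      then show ?thesis
        using p orient_swap[of D A p] orient_swap[of A D p]
        by (cases "orient A D p \<ge> 0")
          (simp_all add: triangle_halfplanes[OF ccw5_pos(10)[OF c]] triangle_halfplanes[OF ccw5_pos(16)[OF c]])
    qed
  qed
  have 3: "convex hull {A, B, C} \<union> convex hull {A, C, D} \<union> convex hull {A, D, E} \<subseteq> convex hull {A, B, C, D, E}"
    by (intro Un_least hull_mono) auto
  from 1 2 3 show "convex hull {A, B, C, D, E} = ?R"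
    "convex hull {A, B, C, D, E} = convex hull {A, B, C} \<union> convex hull {A, C, D} \<union> convex hull {A, D, E}"
    by auto
qed

lemma pentagon_interior:
  assumes c: "ccw5 A B C D E"
    and "orient A B p > 0" "orient B C p > 0" "orient C D p > 0" "orient D E p > 0" "orient E A p > 0"
  shows "p \<in> interior (convex hull {A, B, C, D, E})"
proof (rule interiorI)
  show "open ({p. orient A B p > 0} \<inter> {p. orient B C p > 0} \<inter> {p. orient C D p > 0}
      \<inter> {p. orient D E p > 0} \<inter> {p. orient E A p > 0})"
    by (intro open_Int open_orient_gt)
qed (use assms in \<open>auto simp: pentagon_halfplanes[OF c]\<close>)

lemma orient_midpoint: "orient A B (midpoint C D) = (orient A B C + orient A B D) / 2"
  by (simp add: orient_def midpoint_def algebra_simps) (simp add: field_simps)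

text \<open>For each side, one end of the diagonal is strictly inside and the other is not outside.
  Such a midpoint shows that the interior is nonempty and that no proper face contains two
  nonadjacent corners.\<close>

lemma diagonal_midpoint_interior:
  assumes c: "ccw5 A B C D E"
  shows "midpoint A C \<in> interior (convex hull {A, B, C, D, E})"
  using ccw5_pos[OF c] by (intro pentagon_interior[OF c]) (simp_all add: orient_midpoint)

section \<open>Corners, sides, perimeter and area of a pentagon\<close>

lemma pentagon_side_face:
  assumes c: "ccw5 A B C D E"
  shows "closed_segment A B face_of convex hull {A, B, C, D, E}"
proof -
  let ?P = "convex hull {A, B, C, D, E}"
  let ?n = "vector [A$2 - B$2, B$1 - A$1] :: real^2"
  have F: "?P \<inter> {p. ?n \<bullet> p = ?n \<bullet> A} face_of ?P"
  proof (rule face_of_Int_supporting_hyperplane_ge)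
    show "?n \<bullet> p \<ge> ?n \<bullet> A" if "p \<in> ?P" for p
      using that orient_inner[of A B p] by (simp add: pentagon_halfplanes[OF c])
  qed (rule convex_convex_hull)
  have F2: "?P \<inter> {p. orient A B p = 0} face_of ?P"
    using F by (simp add: orient_halfplane)
  obtain s where s: "s \<subseteq> {A, B, C, D, E}" "?P \<inter> {p. orient A B p = 0} = convex hull s"
    using face_of_convex_hull_subset[OF _ F2] by (auto simp: finite_imp_compact)
  \<comment> \<open>The face cut out by the supporting line AB is the hull of some of the corners,
    and C, D, E are strictly off that line.\<close>
  have "s \<subseteq> {A, B}"
  proof
    fix x assume "x \<in> s"
    then have "x \<in> ?P \<inter> {p. orient A B p = 0}" unfolding s(2) by (rule hull_inc)
    then have "orient A B x = 0" by simp
    then have "x \<noteq> C" "x \<noteq> D" "x \<noteq> E" using ccw5_pos[OF c] by auto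
    then show "x \<in> {A, B}" using s(1) \<open>x \<in> s\<close> by blast
  qed
  then have "convex hull s \<subseteq> closed_segment A B" unfolding segment_convex_hull by (rule hull_mono)
  moreover have "{A, B} \<subseteq> convex hull s" unfolding s(2)[symmetric] by (auto intro: hull_inc)
  then have "closed_segment A B \<subseteq> convex hull s"
    unfolding segment_convex_hull by (intro hull_minimal) auto
  ultimately show ?thesis using F2 s(2) by simp
qed

text \<open>The two sides at A are faces, so their intersection, the single point A, is a face as
  well.\<close>

lemma pentagon_vertex:
  assumes c: "ccw5 A B C D E"
  shows "A extreme_point_of convex hull {A, B, C, D, E}"
proof -
  let ?P = "convex hull {A, B, C, D, E}"
  have c': "ccw5 E A B C D" using c ccw5_rotate by blast
  have "closed_segment E A face_of ?P"
    using pentagon_side_face[OF c'] by (simp add: insert_commute)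
  then have F: "closed_segment A B \<inter> closed_segment E A face_of ?P"
    using pentagon_side_face[OF c] face_of_Int by blast
  have "closed_segment A B \<inter> closed_segment E A = {A}"
  proof -
    have "p = A" if p: "p \<in> closed_segment A B" "p \<in> closed_segment E A" for p
    proof -
      obtain u where u: "p = (1 - u) *\<^sub>R A + u *\<^sub>R B" using p(1) unfolding closed_segment_def by auto
      obtain v where v: "p = (1 - v) *\<^sub>R E + v *\<^sub>R A" using p(2) unfolding closed_segment_def by auto
      have "orient E A p = u * orient E A B" unfolding u by (simp add: orient_def algebra_simps)
      moreover have "orient E A p = 0" unfolding v by (simp add: orient_def algebra_simps)
      moreover have "orient E A B > 0" using c' by (simp add: ccw5_def)
      ultimately show ?thesis using u by simp
    qed
    then show ?thesis by auto
  qed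
  then show ?thesis using F by (simp add: face_of_singleton)
qed

lemma pentagon_vertices:
  assumes c: "ccw5 A B C D E"
  shows "vertices (convex hull {A, B, C, D, E}) = {A, B, C, D, E}"
proof -
  have "X extreme_point_of convex hull {A, B, C, D, E}" if "X \<in> {A, B, C, D, E}" for X
    using that pentagon_vertex[OF c] pentagon_vertex[OF ccw5_rotate[OF c]]
      pentagon_vertex[OF ccw5_rotate[OF ccw5_rotate[OF c]]]
      pentagon_vertex[OF ccw5_rotate[OF ccw5_rotate[OF ccw5_rotate[OF c]]]]
      pentagon_vertex[OF ccw5_rotate[OF ccw5_rotate[OF ccw5_rotate[OF ccw5_rotate[OF c]]]]]
    by (auto simp: insert_commute)
  then show ?thesis unfolding vertices_def using extreme_point_of_convex_hull by blast
qed

lemma pentagon_convex_pentagon: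
  assumes c: "ccw5 A B C D E"
  shows "convex_pentagon (convex hull {A, B, C, D, E})"
proof -
  have "interior (convex hull {A, B, C, D, E}) \<noteq> {}"
    using diagonal_midpoint_interior[OF c] by blast
  moreover have "card {A, B, C, D, E} = 5" using ccw5_distinct[OF c] by simp
  ultimately show ?thesis
    unfolding convex_pentagon_def convex_polygon_def pentagon_vertices[OF c]
    by (simp add: polytope_convex_hull)
qed

lemma pentagon_diagonal_not_face:
  assumes c: "ccw5 A B C D E" and F: "F face_of convex hull {A, B, C, D, E}" "F \<noteq> convex hull {A, B, C, D, E}"
    and "A \<in> F" "C \<in> F"
  shows False
proof -
  have "convex F" using F(1) face_of_imp_convex by blast
  then have "midpoint A C \<in> F" using assms(4,5) 
    by (meson closed_segment_subset midpoint_in_closed_segment subsetD)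
  then show False using diagonal_midpoint_interior[OF c] face_of_disjoint_interior[OF F] by blast
qed

text \<open>An edge is the hull of a set of corners. Dimension one forces at least two of them, and
  no two may be nonadjacent, so it is spanned by two neighbours.\<close>

lemma pentagon_edges:
  assumes c: "ccw5 A B C D E"
  shows "{e. e edge_of convex hull {A, B, C, D, E}} =
    {closed_segment A B, closed_segment B C, closed_segment C D, closed_segment D E, closed_segment E A}"
proof -
  let ?P = "convex hull {A, B, C, D, E}"
  note c1 = ccw5_rotate[OF c]
  note c2 = ccw5_rotate[OF c1]
  note c3 = ccw5_rotate[OF c2]
  note c4 = ccw5_rotate[OF c3]
  have eq: "{B, C, D, E, A} = {A, B, C, D, E}" "{C, D, E, A, B} = {A, B, C, D, E}"
    "{D, E, A, B, C} = {A, B, C, D, E}" "{E, A, B, C, D} = {A, B, C, D, E}" by auto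
  have dim: "aff_dim (closed_segment X Y) = 1" if "X \<noteq> Y" for X Y :: "real^2"
    using that by (simp add: segment_convex_hull aff_dim_convex_hull aff_dim_2)
  have d: "distinct [A, B, C, D, E]" by (rule ccw5_distinct[OF c])
  have R: "closed_segment A B edge_of ?P" "closed_segment B C edge_of ?P" "closed_segment C D edge_of ?P"
    "closed_segment D E edge_of ?P" "closed_segment E A edge_of ?P"
    using pentagon_side_face[OF c] pentagon_side_face[OF c1] pentagon_side_face[OF c2]
      pentagon_side_face[OF c3] pentagon_side_face[OF c4] d
    by (auto simp: edge_of_def dim eq)
  have L: "e \<in> {closed_segment A B, closed_segment B C, closed_segment C D, closed_segment D E, closed_segment E A}"
    if e: "e edge_of ?P" for e
  proof -
    have F: "e face_of ?P" and ad: "aff_dim e = 1" using e by (auto simp: edge_of_def)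
    obtain s where s: "s \<subseteq> {A, B, C, D, E}" "e = convex hull s"
      using face_of_convex_hull_subset[OF _ F] by (auto simp: finite_imp_compact)
    have "aff_dim ?P = 2"
      using diagonal_midpoint_interior[OF c] aff_dim_nonempty_interior[of ?P] by force
    then have ne: "e \<noteq> ?P" using ad by auto
    have se: "X \<in> e" if "X \<in> s" for X using that unfolding s(2) by (rule hull_inc)
    have nd: "\<not> (A \<in> s \<and> C \<in> s)" "\<not> (B \<in> s \<and> D \<in> s)" "\<not> (C \<in> s \<and> E \<in> s)" "\<not> (D \<in> s \<and> A \<in> s)" "\<not> (E \<in> s \<and> B \<in> s)"
      using pentagon_diagonal_not_face[OF c F ne] pentagon_diagonal_not_face[OF c1, unfolded eq, OF F ne]
        pentagon_diagonal_not_face[OF c2, unfolded eq, OF F ne] pentagon_diagonal_not_face[OF c3, unfolded eq, OF F ne]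
        pentagon_diagonal_not_face[OF c4, unfolded eq, OF F ne] se by metis+
    have nn: "s \<noteq> {}" "s \<noteq> {X}" for X using ad s(2) by auto
    have two: "A \<in> s \<and> B \<in> s \<Longrightarrow> s = {A, B}" "B \<in> s \<and> C \<in> s \<Longrightarrow> s = {B, C}" "C \<in> s \<and> D \<in> s \<Longrightarrow> s = {C, D}"
      "D \<in> s \<and> E \<in> s \<Longrightarrow> s = {D, E}" "E \<in> s \<and> A \<in> s \<Longrightarrow> s = {E, A}"
      using s(1) nd by blast+
    have "A \<in> s \<Longrightarrow> B \<in> s \<or> E \<in> s" using s(1) nd nn(2)[of A] by blast
    moreover have "B \<in> s \<Longrightarrow> C \<in> s \<or> A \<in> s" using s(1) nd nn(2)[of B] by blast
    moreover have "C \<in> s \<Longrightarrow> D \<in> s \<or> B \<in> s" using s(1) nd nn(2)[of C] by blast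
    moreover have "D \<in> s \<Longrightarrow> E \<in> s \<or> C \<in> s" using s(1) nd nn(2)[of D] by blast
    moreover have "E \<in> s \<Longrightarrow> A \<in> s \<or> D \<in> s" using s(1) nd nn(2)[of E] by blast
    moreover have "A \<in> s \<or> B \<in> s \<or> C \<in> s \<or> D \<in> s \<or> E \<in> s" using s(1) nn(1) by blast
    ultimately have ex: "s = {A, B} \<or> s = {B, C} \<or> s = {C, D} \<or> s = {D, E} \<or> s = {E, A}"
      using two by argo
    then show ?thesis unfolding s(2) segment_convex_hull by auto
  qed
  show ?thesis using L R by blast
qed

lemma diameter_closed_segment:
  fixes a b :: "'a :: euclidean_space"
  shows "diameter (closed_segment a b) = dist a b"
proof (rule antisym)
  show "diameter (closed_segment a b) \<le> dist a b"
  proof (rule diameter_le)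
    fix x y assume "x \<in> closed_segment a b" "y \<in> closed_segment a b"
    then obtain u v where uv: "0 \<le> u" "u \<le> 1" "0 \<le> v" "v \<le> 1"
        "x = (1 - u) *\<^sub>R a + u *\<^sub>R b" "y = (1 - v) *\<^sub>R a + v *\<^sub>R b"
      by (auto simp: closed_segment_def)
    have "x - y = (v - u) *\<^sub>R (a - b)" unfolding uv(5,6) by (simp add: algebra_simps)
    then have "norm (x - y) = \<bar>v - u\<bar> * dist a b" by (simp add: dist_norm)
    also have "\<dots> \<le> 1 * dist a b" using uv by (intro mult_right_mono) auto
    finally show "norm (x - y) \<le> dist a b" by simp
  qed auto
  show "dist a b \<le> diameter (closed_segment a b)"
    by (intro diameter_bounded_bound bounded_closed_segment) auto
qed

lemma pentagon_perimeter:
  assumes c: "ccw5 A B C D E"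
  shows "perimeter (convex hull {A, B, C, D, E}) = dist A B + dist B C + dist C D + dist D E + dist E A"
proof -
  \<comment> \<open>\<open>perimeter\<close> sums over a set of edges, so coinciding sides would be
    counted only once.\<close>
  have "distinct [closed_segment A B, closed_segment B C, closed_segment C D, closed_segment D E, closed_segment E A]"
    using ccw5_distinct[OF c] by (auto simp: closed_segment_eq doubleton_eq_iff)
  then show ?thesis unfolding perimeter_def pentagon_edges[OF c] by (simp add: diameter_closed_segment)
qed

lemma pentagon_area:
  assumes c: "ccw5 A B C D E"
  shows "area (convex hull {A, B, C, D, E}) = (orient A B C + orient A C D + orient A D E) / 2"
proof -
  have tri: "area (convex hull {X, Y, Z}) = orient X Y Z / 2" if "orient X Y Z > 0" for X Y Z
  proof -
    have "convex hull {X, Y, Z} \<in> sets lborel"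
      by (simp add: borel_compact finite_imp_compact_convex_hull)
    then have "area (convex hull {X, Y, Z}) = measure lborel (convex hull {X, Y, Z})" by simp
    also have "\<dots> = \<bar>orient X Y Z\<bar> / 2"
      unfolding content_triangle by (simp add: orient_def algebra_simps abs_minus_commute)
    finally show ?thesis using that by simp
  qed
  have p: "orient A B C > 0" "orient A C D > 0" "orient A D E > 0" "orient A C E > 0" using c by (auto simp: ccw5_def)
  have m: "convex hull {X, Y, Z} \<in> lmeasurable" for X Y Z :: "real^2"
    by (simp add: finite_imp_compact_convex_hull lmeasurable_compact)
  have ne: "A \<noteq> C" "A \<noteq> D" using ccw5_distinct[OF c] by auto
  have "convex hull {A, B, C} \<inter> convex hull {A, C, D} \<subseteq> {p. orient A C p = 0}"
    using p orient_swap[of A C] by (auto simp: triangle_halfplanes)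
  then have n1: "negligible (convex hull {A, B, C} \<inter> convex hull {A, C, D})"
    using negligible_orient_eq[OF ne(1)] negligible_subset by blast
  have "(convex hull {A, B, C} \<union> convex hull {A, C, D}) \<inter> convex hull {A, D, E} \<subseteq> {p. orient A D p = 0} \<union> {p. orient A C p = 0}"
  proof -
    \<comment> \<open>The third triangle is left of AC and the first is right of it, so these two
      can meet only on the line AC.\<close>
    have "convex hull {A, D, E} \<subseteq> {p. orient A C p \<ge> 0}"
      using p by (intro hull_minimal convex_orient_ge) auto
    then show ?thesis
    using p orient_swap[of A D] orient_swap[of A C] by (force simp: triangle_halfplanes)
  qed
  then have n2: "negligible ((convex hull {A, B, C} \<union> convex hull {A, C, D}) \<inter> convex hull {A, D, E})"
    using negligible_orient_eq[OF ne(1)] negligible_orient_eq[OF ne(2)] negligible_subset negligible_Un by blast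
  show ?thesis
    unfolding pentagon_fan[OF c]
    using n1 n2 m p by (simp add: measure_Un3 negligible_imp_measure0 fmeasurable.Un tri)
qed

section \<open>Solution curves of underdetermined systems\<close>

text \<open>A first-order expansion that is uniform over a narrow cone around the direction v. One
  number s bounds both the aperture and t, and the statement holds eventually as s tends to 0, so
  finitely many functions can share the same s.\<close>

lemma linear_approx_eventually:
  fixes g :: "'a::real_normed_vector \<Rightarrow> real"
  assumes g: "(g has_derivative g') (at 0)" and "\<kappa> > 0"
  shows "\<forall>\<^sub>F s in at_right 0. \<forall>t q. 0 < t \<longrightarrow> t \<le> s \<longrightarrow> norm (q - t *\<^sub>R v) \<le> s * t \<longrightarrow>
           \<bar>g q - g 0 - t * g' v\<bar> \<le> \<kappa> * t"
proof -
  interpret bounded_linear g' using g by (rule has_derivative_bounded_linear)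
  obtain B where B: "B > 0" "\<And>x. \<bar>g' x\<bar> \<le> norm x * B" using pos_bounded by auto
  define K where "K = norm v + 1"
  have K: "K > 0" by (simp add: K_def add_nonneg_pos)
  obtain d where d: "d > 0" "\<And>y. norm y < d \<Longrightarrow> \<bar>g y - g 0 - g' y\<bar> \<le> \<kappa> / (2 * K) * norm y"
    using g K \<open>\<kappa> > 0\<close> unfolding has_derivative_at_alt
    by (metis diff_zero divide_pos_pos mult_pos_pos real_norm_def zero_less_numeral)
  \<comment> \<open>The bound 1 gives |q| <= t K, the bound d / K keeps q where the expansion is
    accurate, and the last bound limits the effect of replacing q by t v to half of the
    error.\<close>
  have "\<forall>\<^sub>F s in at_right 0. s < min 1 (min (d / K) (\<kappa> / (2 * B)))"
    using B(1) K d(1) \<open>\<kappa> > 0\<close>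
    by (auto simp: eventually_at_right_field intro!: exI[of _ "min 1 (min (d / K) (\<kappa> / (2 * B)))"])
  then show ?thesis
  proof (rule eventually_mono, intro allI impI)
    fix s t q assume s: "s < min 1 (min (d / K) (\<kappa> / (2 * B)))" and t: "0 < t" "t \<le> s"
      and q: "norm (q - t *\<^sub>R v) \<le> s * t"
    have "norm q \<le> norm (t *\<^sub>R v) + norm (q - t *\<^sub>R v)" by (rule norm_triangle_sub)
    also have "\<dots> \<le> t * norm v + s * t" using q t by simp
    also have "\<dots> \<le> t * K" using s t by (simp add: K_def algebra_simps)
    finally have nq: "norm q \<le> t * K" .
    also have "t * K \<le> s * K" using t K by simp
    also have "s * K < d" using s K by (simp add: field_simps)
    finally have "\<bar>g q - g 0 - g' q\<bar> \<le> \<kappa> / (2 * K) * norm q" by (rule d(2))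
    also have "\<dots> \<le> \<kappa> / (2 * K) * (t * K)" using nq K \<open>\<kappa> > 0\<close> by (intro mult_left_mono) auto
    also have "\<dots> = \<kappa> / 2 * t" using K by simp
    finally have 1: "\<bar>g q - g 0 - g' q\<bar> \<le> \<kappa> / 2 * t" .
    have "g' q - t * g' v = g' (q - t *\<^sub>R v)" by (simp add: diff scaleR)
    then have "\<bar>g' q - t * g' v\<bar> \<le> norm (q - t *\<^sub>R v) * B" using B(2) by simp
    also have "\<dots> \<le> (s * t) * B" using q B(1) by (intro mult_right_mono) auto
    also have "\<dots> \<le> \<kappa> / 2 * t" using s t B(1) by (simp add: field_simps)
    finally have 2: "\<bar>g' q - t * g' v\<bar> \<le> \<kappa> / 2 * t" .
    show "\<bar>g q - g 0 - t * g' v\<bar> \<le> \<kappa> * t" using 1 2 by linarith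
  qed
qed

text \<open>With G the inverse of L, Brouwer's theorem is applied to y -> t v + y - G (F y). This
  maps the ball of radius \<eta> t about t v into itself, since F y - L y is small compared with
  y.\<close>

lemma solutions_along_tangent:
  fixes F :: "'a::euclidean_space \<Rightarrow> 'a"
  assumes cont: "continuous_on UNIV F" and der: "(F has_derivative L) (at 0)"
    and F0: "F 0 = 0" and inj: "inj L" and "\<eta> > 0"
  shows "\<exists>\<tau>>0. \<forall>t. 0 < t \<longrightarrow> t \<le> \<tau> \<longrightarrow> (\<exists>q. F q = t *\<^sub>R L v \<and> norm (q - t *\<^sub>R v) \<le> \<eta> * t)"
proof -
  have lin: "linear L" using der has_derivative_linear by blast
  then obtain G where G: "linear G" "\<And>x. L (G x) = x" "\<And>x. G (L x) = x"
    using linear_injective_isomorphism[OF lin inj] by auto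
  have bG: "bounded_linear G" using G(1) by (simp add: linear_conv_bounded_linear)
  then obtain B where B: "B > 0" "\<And>x. norm (G x) \<le> norm x * B" using bounded_linear.pos_bounded by blast
  define K where "K = norm v + \<eta>"
  have K: "K > 0" using \<open>\<eta> > 0\<close> by (simp add: K_def add_nonneg_pos)
  \<comment> \<open>Points of the ball have norm at most t K and G enlarges norms by at most B, so
    this tolerance yields an error of at most \<eta> t.\<close>
  have "\<eta> / (B * K) > 0" using B K \<open>\<eta> > 0\<close> by simp
  then obtain d where d: "d > 0" "\<And>y. norm y < d \<Longrightarrow> norm (F y - L y) \<le> \<eta> / (B * K) * norm y"
    using der F0 unfolding has_derivative_at_alt by (metis diff_zero)
  show ?thesis
  proof (intro exI[of _ "d / (2 * K)"] conjI allI impI)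
    show "d / (2 * K) > 0" using d K by simp
    fix t :: real assume t: "0 < t" "t \<le> d / (2 * K)"
    have "\<exists>y\<in>cball (t *\<^sub>R v) (\<eta> * t). G (F y) = t *\<^sub>R v"
    proof (rule brouwer_surjective_cball[where S = "{t *\<^sub>R v}"])
      show "continuous_on (cball (t *\<^sub>R v) (\<eta> * t)) (\<lambda>y. G (F y))"
        using cont bG by (intro bounded_linear.continuous_on[OF bG]) (auto intro: continuous_on_subset)
      fix x y assume x: "x \<in> {t *\<^sub>R v}" and y: "y \<in> cball (t *\<^sub>R v) (\<eta> * t)"
      have "norm y \<le> norm (t *\<^sub>R v) + norm (y - t *\<^sub>R v)" by (rule norm_triangle_sub)
      also have "\<dots> \<le> t * norm v + \<eta> * t" using y t by (simp add: dist_norm norm_minus_commute)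
      finally have ny: "norm y \<le> t * K" by (simp add: K_def algebra_simps)
      have "t * K < d" using t K d(1) by (simp add: field_simps)
      then have "norm (F y - L y) \<le> \<eta> / (B * K) * norm y" using ny by (intro d(2)) linarith
      also have "\<dots> \<le> \<eta> / (B * K) * (t * K)" using ny B K \<open>\<eta> > 0\<close> by (intro mult_left_mono) auto
      also have "\<dots> = \<eta> * t / B" using K by simp
      finally have "norm (F y - L y) * B \<le> \<eta> * t" using B by (simp add: field_simps)
      moreover have "norm (G (F y - L y)) \<le> norm (F y - L y) * B" by (rule B)
      ultimately have "norm (G (F y) - y) \<le> \<eta> * t" using G by (simp add: linear_diff)
      then show "x + (y - G (F y)) \<in> cball (t *\<^sub>R v) (\<eta> * t)"
        using x by (simp add: dist_norm norm_minus_commute algebra_simps)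
    qed (use t \<open>\<eta> > 0\<close> in auto)
    then obtain y where y: "norm (y - t *\<^sub>R v) \<le> \<eta> * t" "G (F y) = t *\<^sub>R v" 
      by (auto simp: dist_norm norm_minus_commute)
    have "F y = L (t *\<^sub>R v)" using y(2) G(2)[of "F y"] by simp
    then show "\<exists>q. F q = t *\<^sub>R L v \<and> norm (q - t *\<^sub>R v) \<le> \<eta> * t"
      using y(1) lin by (auto simp: linear_scale)
  qed
qed

section \<open>Fair blocks\<close>

type_synonym offset = "real \<times> real \<times> real"

abbreviation \<xi> :: "offset \<Rightarrow> real" where "\<xi> X \<equiv> fst X"
abbreviation \<upsilon> :: "offset \<Rightarrow> real" where "\<upsilon> X \<equiv> fst (snd X)"
abbreviation \<phi> :: "offset \<Rightarrow> real" where "\<phi> X \<equiv> snd (snd X)"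

definition len :: "real \<Rightarrow> real \<Rightarrow> real" where "len a b = sqrt (a\<^sup>2 + b\<^sup>2)"

text \<open>
  The coordinate \<open>\<phi>\<close> moves the foot of the wall along the boundary line of the strip, the other two move
  the zigzag vertex; \<open>\<upsilon>\<close> is measured away from the centre line of the strip, so that upper and lower tiles
  obey the same formulas. All offsets vanish for the tiling by congruent pentagons with corners
  \<open>(6, 11), (0, 3), (8, -3), (16, 3), (22, 11)\<close>.
\<close>

definition tile_perimeter :: "offset \<Rightarrow> offset \<Rightarrow> offset \<Rightarrow> real" where
  "tile_perimeter X Y Z =
     len (6 + \<phi> X - \<xi> X) (8 - \<upsilon> X) + len (8 + \<xi> Y - \<xi> X) (6 + \<upsilon> X + \<upsilon> Y) +
     len (8 + \<xi> Z - \<xi> Y) (6 + \<upsilon> Y + \<upsilon> Z) + len (6 + \<phi> Z - \<xi> Z) (8 - \<upsilon> Z) + (16 + \<phi> Z - \<phi> X)"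

text \<open>The shoelace formula for the five corners.\<close>

definition tile_area :: "offset \<Rightarrow> offset \<Rightarrow> offset \<Rightarrow> real" where
  "tile_area X Y Z =
    ((6 + \<phi> X) * (3 + \<upsilon> X) - \<xi> X * 11 - \<xi> X * (3 + \<upsilon> Y) - (8 + \<xi> Y) * (3 + \<upsilon> X)
      + (8 + \<xi> Y) * (3 + \<upsilon> Z) + (16 + \<xi> Z) * (3 + \<upsilon> Y) + (16 + \<xi> Z) * 11 - (22 + \<phi> Z) * (3 + \<upsilon> Z)
      + (22 + \<phi> Z) * 11 - (6 + \<phi> X) * 11) / 2"

text \<open>The squared distances of the ten unordered pairs of corners; the pair on the boundary
  line of the strip contributes a single square.\<close>

definition tile_moment :: "offset \<Rightarrow> offset \<Rightarrow> offset \<Rightarrow> real" where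
  "tile_moment X Y Z =
     (6 + \<phi> X - \<xi> X)\<^sup>2 + (8 - \<upsilon> X)\<^sup>2 + (2 - \<phi> X + \<xi> Y)\<^sup>2 + (14 + \<upsilon> Y)\<^sup>2 +
     (10 + \<xi> Z - \<phi> X)\<^sup>2 + (8 - \<upsilon> Z)\<^sup>2 + (16 + \<phi> Z - \<phi> X)\<^sup>2 +
     (8 + \<xi> Y - \<xi> X)\<^sup>2 + (6 + \<upsilon> X + \<upsilon> Y)\<^sup>2 + (16 + \<xi> Z - \<xi> X)\<^sup>2 + (\<upsilon> Z - \<upsilon> X)\<^sup>2 +
     (22 + \<phi> Z - \<xi> X)\<^sup>2 + (8 - \<upsilon> X)\<^sup>2 + (8 + \<xi> Z - \<xi> Y)\<^sup>2 + (6 + \<upsilon> Y + \<upsilon> Z)\<^sup>2 +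
     (14 + \<phi> Z - \<xi> Y)\<^sup>2 + (14 + \<upsilon> Y)\<^sup>2 + (6 + \<phi> Z - \<xi> Z)\<^sup>2 + (8 - \<upsilon> Z)\<^sup>2"

text \<open>The differential at zero offsets. The coordinate \<open>\<xi> Y\<close> cancels: a
  horizontal shift of the middle vertex lengthens one zigzag edge as much as it shortens the other.
  It cancels in the area too, as the shift is parallel to the line through the neighbouring zigzag
  vertices.\<close>

definition perimeter_deriv :: "offset \<Rightarrow> offset \<Rightarrow> offset \<Rightarrow> real" where
  "perimeter_deriv X Y Z =
     (8 * \<phi> Z - 2 * \<phi> X - 7 * \<xi> X + \<xi> Z - \<upsilon> X + 6 * \<upsilon> Y - \<upsilon> Z) / 5"

definition area_deriv :: "offset \<Rightarrow> offset \<Rightarrow> offset \<Rightarrow> real" where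
  "area_deriv X Y Z = 4 * \<phi> Z - 4 * \<phi> X - 7 * \<xi> X - \<upsilon> X + 8 * \<upsilon> Y + 7 * \<xi> Z - 7 * \<upsilon> Z"

definition moment_deriv :: "offset \<Rightarrow> offset \<Rightarrow> offset \<Rightarrow> real" where
  "moment_deriv X Y Z =
     116 * \<phi> Z - 44 * \<phi> X - 104 * \<xi> X - 20 * \<upsilon> X - 24 * \<xi> Y + 80 * \<upsilon> Y + 56 * \<xi> Z - 20 * \<upsilon> Z"

section \<open>Derivatives at the congruent tiling\<close>

lemma len_has_derivative:
  fixes f g :: "'a::real_normed_vector \<Rightarrow> real"
  assumes "(f has_derivative f') (at x)" "(g has_derivative g') (at x)" "f x = a" "g x = b" "a\<^sup>2 + b\<^sup>2 = c\<^sup>2" "c > 0"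
  shows "((\<lambda>q. len (f q) (g q)) has_derivative (\<lambda>h. (a * f' h + b * g' h) / c)) (at x)"
proof -
  have d: "((\<lambda>q. (f q)\<^sup>2 + (g q)\<^sup>2) has_derivative (\<lambda>h. 2 * (a * f' h + b * g' h))) (at x)"
    by (rule derivative_eq_intros assms refl | simp add: assms algebra_simps)+
  have c: "(f x)\<^sup>2 + (g x)\<^sup>2 = c\<^sup>2" using assms by simp
  then have "(f x)\<^sup>2 + (g x)\<^sup>2 > 0" using \<open>c > 0\<close> by simp
  note s = has_derivative_real_sqrt[OF this d]
  have "sqrt ((f x)\<^sup>2 + (g x)\<^sup>2) = c" using c \<open>c > 0\<close> by simp
  then have "(\<lambda>h. 2 * (a * f' h + b * g' h) * (inverse (sqrt ((f x)\<^sup>2 + (g x)\<^sup>2)) / 2)) = (\<lambda>h. (a * f' h + b * g' h) / c)"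
    by (simp only: divide_inverse fun_eq_iff) simp
  with s show ?thesis unfolding len_def by simp
qed

lemma tile_perimeter_has_derivative:
  assumes "(X has_derivative X') (at q)" "(Y has_derivative Y') (at q)" "(Z has_derivative Z') (at q)"
    "X q = 0" "Y q = 0" "Z q = 0"
  shows "((\<lambda>p. tile_perimeter (X p) (Y p) (Z p)) has_derivative (\<lambda>h. perimeter_deriv (X' h) (Y' h) (Z' h))) (at q)"
  unfolding tile_perimeter_def
  \<comment> \<open>At zero offsets each of the four slanted sides has legs 6 and 8, hence length
    10.\<close>
  apply (rule derivative_eq_intros len_has_derivative[where c = 10] assms refl | simp add: assms)+
  apply (simp add: perimeter_deriv_def fun_eq_iff field_simps)
  done

lemma tile_area_has_derivative:
  assumes "(X has_derivative X') (at q)" "(Y has_derivative Y') (at q)" "(Z has_derivative Z') (at q)"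
    "X q = 0" "Y q = 0" "Z q = 0"
  shows "((\<lambda>p. tile_area (X p) (Y p) (Z p)) has_derivative (\<lambda>h. area_deriv (X' h) (Y' h) (Z' h))) (at q)"
  unfolding tile_area_def
  apply (rule derivative_eq_intros assms refl | simp add: assms)+
  apply (simp add: area_deriv_def fun_eq_iff field_simps)
  done

lemma tile_moment_has_derivative:
  assumes "(X has_derivative X') (at q)" "(Y has_derivative Y') (at q)" "(Z has_derivative Z') (at q)"
    "X q = 0" "Y q = 0" "Z q = 0"
  shows "((\<lambda>p. tile_moment (X p) (Y p) (Z p)) has_derivative (\<lambda>h. moment_deriv (X' h) (Y' h) (Z' h))) (at q)"
  unfolding tile_moment_def
  apply (rule derivative_eq_intros assms refl | simp add: assms)+
  apply (simp add: moment_deriv_def fun_eq_iff field_simps)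
  done

section \<open>Blocks of six tiles and their linearised conditions\<close>

type_synonym block = "offset \<times> offset \<times> offset \<times> offset"

text \<open>Tile i uses the offsets i, i + 1 and i + 2, so six tiles use 0 to 7. The zeros at 0, 1,
  6 and 7 let any block be followed by any other.\<close>

definition block_offset :: "block \<Rightarrow> nat \<Rightarrow> offset" where
  "block_offset q i = (if i = 2 then fst q else if i = 3 then fst (snd q)
     else if i = 4 then fst (snd (snd q)) else if i = 5 then snd (snd (snd q)) else 0)"

lemma bounded_linear_block_offset: "bounded_linear (\<lambda>q. block_offset q i)"
proof -
  consider "i = 2" | "i = 3" | "i = 4" | "i = 5" | "i \<noteq> 2" "i \<noteq> 3" "i \<noteq> 4" "i \<noteq> 5" by blast
  then show ?thesis
    by cases (simp_all add: block_offset_def bounded_linear_fst bounded_linear_snd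
      bounded_linear_zero bounded_linear_fst_comp bounded_linear_snd_comp)
qed

abbreviation on_tile :: "(offset \<Rightarrow> offset \<Rightarrow> offset \<Rightarrow> real) \<Rightarrow> block \<Rightarrow> nat \<Rightarrow> real" where
  "on_tile f q i \<equiv> f (block_offset q i) (block_offset q (i + 1)) (block_offset q (i + 2))"

lemma block_offset_0 [simp]: "block_offset 0 i = 0"
  by (simp add: block_offset_def zero_prod_def)

lemma on_tile_has_derivative:
  "((\<lambda>q. on_tile tile_perimeter q i) has_derivative (\<lambda>h. on_tile perimeter_deriv h i)) (at 0)"
  "((\<lambda>q. on_tile tile_area q i) has_derivative (\<lambda>h. on_tile area_deriv h i)) (at 0)"
  "((\<lambda>q. on_tile tile_moment q i) has_derivative (\<lambda>h. on_tile moment_deriv h i)) (at 0)"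
  by (intro tile_perimeter_has_derivative tile_area_has_derivative tile_moment_has_derivative
      bounded_linear_imp_has_derivative bounded_linear_block_offset block_offset_0)+

text \<open>
  The area of the sixth tile is omitted because the areas of a block have a constant sum; its place is taken by the
  parameter \<open>t = - \<xi>\<close> of the solution curve.
\<close>

definition block_map :: "block \<Rightarrow> block" where
  "block_map q =
    ((on_tile tile_perimeter q 0 - 56, on_tile tile_perimeter q 1 - 56, on_tile tile_perimeter q 2 - 56),
     (on_tile tile_perimeter q 3 - 56, on_tile tile_perimeter q 4 - 56, on_tile tile_perimeter q 5 - 56),
     (on_tile tile_area q 0 - 176, on_tile tile_area q 1 - 176, on_tile tile_area q 2 - 176),
     (on_tile tile_area q 3 - 176, on_tile tile_area q 4 - 176, - \<xi> (block_offset q 5)))"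

definition block_deriv :: "block \<Rightarrow> block" where
  "block_deriv h =
    ((on_tile perimeter_deriv h 0, on_tile perimeter_deriv h 1, on_tile perimeter_deriv h 2),
     (on_tile perimeter_deriv h 3, on_tile perimeter_deriv h 4, on_tile perimeter_deriv h 5),
     (on_tile area_deriv h 0, on_tile area_deriv h 1, on_tile area_deriv h 2),
     (on_tile area_deriv h 3, on_tile area_deriv h 4, - \<xi> (block_offset h 5)))"

lemma block_map_has_derivative: "(block_map has_derivative block_deriv) (at 0)"
proof -
  have x: "((\<lambda>q. - \<xi> (block_offset q 5)) has_derivative (\<lambda>h. - \<xi> (block_offset h 5))) (at 0)"
    by (intro bounded_linear_imp_has_derivative bounded_linear_minus bounded_linear_fst_comp bounded_linear_block_offset)
  have d: "(f has_derivative f') (at 0) \<Longrightarrow> ((\<lambda>q. f q - c) has_derivative f') (at 0)"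
    for f f' :: "block \<Rightarrow> real" and c
    by (auto intro!: derivative_eq_intros)
  show ?thesis
    unfolding block_map_def block_deriv_def
    by (intro has_derivative_Pair d on_tile_has_derivative x)
qed

lemma continuous_on_tile:
  assumes "continuous_on S X" "continuous_on S Y" "continuous_on S Z"
  shows "continuous_on S (\<lambda>p. tile_perimeter (X p) (Y p) (Z p))"
    and "continuous_on S (\<lambda>p. tile_area (X p) (Y p) (Z p))"
  unfolding tile_perimeter_def tile_area_def len_def
  by (intro continuous_intros assms; simp)+

lemma continuous_block_map: "continuous_on UNIV block_map"
  unfolding block_map_def
  by (intro continuous_on_Pair continuous_on_diff continuous_on_tile continuous_on_const continuous_on_minus
      continuous_on_fst linear_continuous_on bounded_linear_block_offset)

lemma block_map_0: "block_map 0 = 0"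
proof -
  have "len 6 8 = 10" "len 8 6 = 10" unfolding len_def by (rule real_sqrt_unique; simp)+
  then show ?thesis
    by (simp add: block_map_def tile_perimeter_def tile_area_def flip: zero_prod_def)
qed

text \<open>Spans the kernel of the linearised area and perimeter conditions.\<close>

definition block_dir :: block where
  "block_dir = ((26, 26, 0), (6, 26, -17), (3, 7, 7), (-1, 7, 0))"

text \<open>Only the last component moves, at unit rate. Solving for multiples of this value
  therefore keeps all perimeters and the five listed areas exact while the last component equals the
  parameter t.\<close>

lemma block_deriv_dir: "block_deriv block_dir = (0, 0, 0, (0, 0, 1))"
  by (simp add: block_deriv_def block_dir_def block_offset_def perimeter_deriv_def area_deriv_def zero_prod_def)

text \<open>Elimination, with d1 = 0 already inserted and tiles counted from 0. Tiles 0, 1 and 2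
  express the second and third coordinates of a, b, c through earlier unknowns and the first
  coordinates; tiles 4 and 5 tie d to c. Together with tile 3 this forces c1 = 0 and then everything
  else.\<close>

lemma block_system_trivial:
  fixes a1 :: real
  assumes "8*a3 + a1 - a2 = 0" "4*a3 + 7*a1 - 7*a2 = 0"
   "8*b3 + b1 + 6*a2 - b2 = 0" "4*b3 + 8*a2 + 7*b1 - 7*b2 = 0"
   "8*c3 - 2*a3 - 7*a1 + c1 - a2 + 6*b2 - c2 = 0" "4*c3 - 4*a3 - 7*a1 - a2 + 8*b2 + 7*c1 - 7*c2 = 0"
   "8*d3 - 2*b3 - 7*b1 - b2 + 6*c2 - d2 = 0" "4*d3 - 4*b3 - 7*b1 - b2 + 8*c2 - 7*d2 = 0"
   "6*d2 - 2*c3 - 7*c1 - c2 = 0" "8*d2 - 4*c3 - 7*c1 - c2 = 0" "2*d3 + d2 = 0"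
  shows "a1 = 0 \<and> a2 = 0 \<and> a3 = 0 \<and> b1 = 0 \<and> b2 = 0 \<and> b3 = 0 \<and> c1 = 0 \<and> c2 = 0 \<and> c3 = 0 \<and> d2 = 0 \<and> d3 = 0"
proof -
  have a: "a3 = 0" "a2 = a1" using assms(1,2) by linarith+
  have b: "b2 = b1 + 10/13 * a1" "b3 = - 17/26 * a1" using assms(3,4) unfolding a by linarith+
  have c: "13 * c2 = 13 * c1 - 8 * a1 + 10 * b2" "26 * c3 = 24 * a1 - 17 * b2" using assms(5,6) a by linarith+
  have d: "c3 = d2" "2 * d3 = - d2" using assms(9-11) by linarith+
  have "c1 = 0" 
    using assms(7-9) b c d by linarith
  have "c2 = 4 * d2" using assms(9) d(1) \<open>c1 = 0\<close> by linarith
  then have "a1 = 0" "b1 = 0" using assms(7,8) b c d \<open>c1 = 0\<close> by linarith+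
  then have b0: "b2 = 0" "b3 = 0" using b by simp_all
  then have c0: "c2 = 0" "c3 = 0" using c \<open>a1 = 0\<close> \<open>c1 = 0\<close> by simp_all
  show ?thesis using \<open>a1 = 0\<close> \<open>b1 = 0\<close> \<open>c1 = 0\<close> a b0 c0 d by simp
qed

lemma inj_block_deriv: "inj block_deriv"
proof -
  have "linear block_deriv"
    using block_map_has_derivative has_derivative_linear by blast
  moreover have "q = 0" if "block_deriv q = 0" for q
  proof -
    obtain a1 a2 a3 b1 b2 b3 c1 c2 c3 d1 d2 d3 where q: "q = ((a1, a2, a3), (b1, b2, b3), (c1, c2, c3), (d1, d2, d3))"
      by (metis prod.collapse)
    note defs = q block_deriv_def block_offset_def perimeter_deriv_def area_deriv_def zero_prod_def
    have d1: "d1 = 0" using arg_cong[OF that, of "\<lambda>x. snd (snd (snd (snd (snd x))))"] by (simp add: defs)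
    have e0: "8*a3 + a1 - a2 = 0"
      using arg_cong[OF that, of "\<lambda>x. fst (fst x)"] d1 by (simp add: defs)
    have e1: "4*a3 + 7*a1 - 7*a2 = 0"
      using arg_cong[OF that, of "\<lambda>x. fst (fst (snd (snd x)))"] d1 by (simp add: defs)
    have e2: "8*b3 + b1 + 6*a2 - b2 = 0"
      using arg_cong[OF that, of "\<lambda>x. fst (snd (fst x))"] d1 by (simp add: defs)
    have e3: "4*b3 + 8*a2 + 7*b1 - 7*b2 = 0"
      using arg_cong[OF that, of "\<lambda>x. fst (snd (fst (snd (snd x))))"] d1 by (simp add: defs)
    have e4: "8*c3 - 2*a3 - 7*a1 + c1 - a2 + 6*b2 - c2 = 0"
      using arg_cong[OF that, of "\<lambda>x. snd (snd (fst x))"] d1 by (simp add: defs)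
    have e5: "4*c3 - 4*a3 - 7*a1 - a2 + 8*b2 + 7*c1 - 7*c2 = 0"
      using arg_cong[OF that, of "\<lambda>x. snd (snd (fst (snd (snd x))))"] d1 by (simp add: defs)
    have e6: "8*d3 - 2*b3 - 7*b1 - b2 + 6*c2 - d2 = 0"
      using arg_cong[OF that, of "\<lambda>x. fst (fst (snd x))"] d1 by (simp add: defs)
    have e7: "4*d3 - 4*b3 - 7*b1 - b2 + 8*c2 - 7*d2 = 0"
      using arg_cong[OF that, of "\<lambda>x. fst (snd (snd (snd x)))"] d1 by (simp add: defs)
    have e8: "6*d2 - 2*c3 - 7*c1 - c2 = 0"
      using arg_cong[OF that, of "\<lambda>x. fst (snd (fst (snd x)))"] d1 by (simp add: defs)
    have e9: "8*d2 - 4*c3 - 7*c1 - c2 = 0"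
      using arg_cong[OF that, of "\<lambda>x. fst (snd (snd (snd (snd x))))"] d1 by (simp add: defs)
    have e10: "2*d3 + d2 = 0"
      using arg_cong[OF that, of "\<lambda>x. snd (snd (fst (snd x)))"] d1 by (simp add: defs)
    note block_system_trivial[OF e0 e1 e2 e3 e4 e5 e6 e7 e8 e9 e10]
    with d1 show ?thesis by (simp add: q zero_prod_def)
  qed
  ultimately show ?thesis by (simp add: linear_injective_0)
qed

text \<open>The zero offsets at both ends fix the outer boundary of the block, so only the
  distribution of the total area 6 * 176 can change.\<close>

lemma block_area_total:
  "on_tile tile_area q 0 + on_tile tile_area q 1 + on_tile tile_area q 2 + on_tile tile_area q 3
     + on_tile tile_area q 4 + on_tile tile_area q 5 = 1056"
  by (simp add: block_offset_def tile_area_def field_simps)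

lemma less_6_cases:
  fixes i :: nat
  assumes "i < 6" obtains "i = 0" | "i = 1" | "i = 2" | "i = 3" | "i = 4" | "i = 5"
  using assms by linarith

lemma block_map_solution:
  assumes "block_map q = (0, 0, 0, (0, 0, t))" "i < 6"
  shows "on_tile tile_perimeter q i = 56" "on_tile tile_area q i = 176"
proof -
  note a = assms(1)[unfolded block_map_def zero_prod_def prod.inject right_minus_eq]
  have "on_tile tile_perimeter q 0 = 56" "on_tile tile_perimeter q 1 = 56" "on_tile tile_perimeter q 2 = 56"
    "on_tile tile_perimeter q 3 = 56" "on_tile tile_perimeter q 4 = 56" "on_tile tile_perimeter q 5 = 56"
    using a by blast+
  note p = this
  have "on_tile tile_area q 0 = 176" "on_tile tile_area q 1 = 176" "on_tile tile_area q 2 = 176"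
    "on_tile tile_area q 3 = 176" "on_tile tile_area q 4 = 176"
    using a by blast+
  note r = this
  have r5: "on_tile tile_area q 5 = 176" using block_area_total[of q] unfolding r by simp
  show "on_tile tile_perimeter q i = 56"
    by (rule less_6_cases[OF assms(2)]) (simp_all only: p)
  show "on_tile tile_area q i = 176"
    by (rule less_6_cases[OF assms(2)]) (simp_all only: r r5)
qed

text \<open>
  These six rates are distinct and nonzero, so along the solution curve the moments of the six tiles separate at first order,
  both from each other and from their values at other, much smaller, parameters.
\<close>

definition moment_rate :: "nat \<Rightarrow> real" where
  "moment_rate i = on_tile moment_deriv block_dir i"

lemma moment_rate_values:
  "moment_rate 0 = 936" "moment_rate 1 = - 700" "moment_rate 2 = - 448"
  "moment_rate 3 = - 104" "moment_rate 4 = - 176" "moment_rate 5 = - 36"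
  by (simp_all add: moment_rate_def moment_deriv_def block_dir_def block_offset_def)

lemma moment_rate_bounds: "i < 6 \<Longrightarrow> 36 \<le> \<bar>moment_rate i\<bar> \<and> \<bar>moment_rate i\<bar> \<le> 936"
  by (erule less_6_cases; simp add: moment_rate_values del: One_nat_def)

lemma moment_rate_separated: "i < 6 \<Longrightarrow> j < 6 \<Longrightarrow> i \<noteq> j \<Longrightarrow> 36 \<le> \<bar>moment_rate i - moment_rate j\<bar>"
  by (erule less_6_cases; erule less_6_cases; simp add: moment_rate_values del: One_nat_def)

section \<open>Choice of a sequence of fair blocks\<close>

definition small :: "offset \<Rightarrow> bool" where
  "small X \<longleftrightarrow> \<bar>\<xi> X\<bar> \<le> 1/100 \<and> \<bar>\<upsilon> X\<bar> \<le> 1/100 \<and> \<bar>\<phi> X\<bar> \<le> 1/100"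

lemma small_0 [simp]: "small 0"
  by (simp add: small_def zero_prod_def)

lemma small_block_offset:
  assumes "norm q \<le> 1/100" shows "small (block_offset q i)"
proof -
  have "norm (fst x) \<le> norm x" "norm (snd x) \<le> norm x" for x :: "'x::real_normed_vector \<times> 'y::real_normed_vector"
    by (metis prod.collapse norm_fst_le, metis prod.collapse norm_snd_le)
  note n = this
  have "norm (snd (snd (snd q))) \<le> norm q" "norm (fst (snd (snd q))) \<le> norm q"
      "norm (fst (snd q)) \<le> norm q" "norm (fst q) \<le> norm q"
    using n(1)[of q] n(2)[of q] n(1)[of "snd q"] n(2)[of "snd q"] n(1)[of "snd (snd q)"] n(2)[of "snd (snd q)"]
    by linarith+
  then have "norm (block_offset q i) \<le> norm q"
    unfolding block_offset_def by (auto simp del: One_nat_def)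
  then have b: "norm (block_offset q i) \<le> 1/100" using assms by linarith
  have "norm (\<xi> X) \<le> norm X" "norm (\<upsilon> X) \<le> norm X" "norm (\<phi> X) \<le> norm X" for X :: offset
    using n(1)[of X] n(2)[of X] n(1)[of "snd X"] n(2)[of "snd X"] by linarith+
  then have "\<bar>\<xi> X\<bar> \<le> norm X" "\<bar>\<upsilon> X\<bar> \<le> norm X" "\<bar>\<phi> X\<bar> \<le> norm X" for X :: offset
    unfolding real_norm_def by blast+
  then show ?thesis unfolding small_def using b order_trans by blast
qed

lemma fair_blocks:
  obtains Q :: "nat \<Rightarrow> block" where
    "\<And>n i. small (block_offset (Q n) i)"
    "\<And>n i. i < 6 \<Longrightarrow> on_tile tile_perimeter (Q n) i = 56"
    "\<And>n i. i < 6 \<Longrightarrow> on_tile tile_area (Q n) i = 176"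
    "\<And>n m i j. i < 6 \<Longrightarrow> j < 6 \<Longrightarrow> on_tile tile_moment (Q n) i = on_tile tile_moment (Q m) j \<Longrightarrow> n = m \<and> i = j"
proof -
  let ?v = block_dir
  \<comment> \<open>The error constant 1 is ample, because the rates and their differences are at
    least 36 in absolute value.\<close>
  have "\<forall>\<^sub>F s in at_right 0. \<forall>i\<in>{..<6}. \<forall>t q. 0 < t \<longrightarrow> t \<le> s \<longrightarrow> norm (q - t *\<^sub>R ?v) \<le> s * t \<longrightarrow>
      \<bar>on_tile tile_moment q i - on_tile tile_moment 0 i - t * on_tile moment_deriv ?v i\<bar> \<le> 1 * t"
    by (intro eventually_ball_finite ballI linear_approx_eventually on_tile_has_derivative) auto
  moreover have "\<forall>\<^sub>F s :: real in at_right 0. 0 < s \<and> s < 1"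
    using eventually_at_right_real[of 0 "1 :: real"] by simp
  ultimately have "\<forall>\<^sub>F s in at_right 0. (0 < s \<and> s < 1) \<and> (\<forall>i<6. \<forall>t q. 0 < t \<longrightarrow> t \<le> s \<longrightarrow> norm (q - t *\<^sub>R ?v) \<le> s * t \<longrightarrow>
      \<bar>on_tile tile_moment q i - tile_moment 0 0 0 - t * moment_rate i\<bar> \<le> t)"
    by eventually_elim (simp add: moment_rate_def)
  then obtain s :: real where s: "0 < s" "s < 1"
    and mom: "\<And>i t q. i < 6 \<Longrightarrow> 0 < t \<Longrightarrow> t \<le> s \<Longrightarrow> norm (q - t *\<^sub>R ?v) \<le> s * t \<Longrightarrow>
      \<bar>on_tile tile_moment q i - tile_moment 0 0 0 - t * moment_rate i\<bar> \<le> t"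
    using eventually_happens'[OF trivial_limit_at_right_real] by blast
  obtain \<tau>' where \<tau>': "\<tau>' > 0"
    and sol: "\<And>t. 0 < t \<Longrightarrow> t \<le> \<tau>' \<Longrightarrow> \<exists>q. block_map q = t *\<^sub>R block_deriv ?v \<and> norm (q - t *\<^sub>R ?v) \<le> s * t"
    using solutions_along_tangent[OF continuous_block_map block_map_has_derivative block_map_0 inj_block_deriv s(1)] by blast
  \<comment> \<open>As s < 1, a solution with parameter t has norm at most t K; the third bound in
    \<open>\<tau>\<close> then makes it at most 1/100.\<close>
  define K where "K = norm ?v + 1"
  have K: "K > 0" by (simp add: K_def add_nonneg_pos)
  define \<tau> where "\<tau> = min s (min \<tau>' (1 / (100 * K)))"
  have \<tau>: "\<tau> > 0" "\<tau> \<le> s" "\<tau> \<le> \<tau>'" "\<tau> \<le> 1 / (100 * K)"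
    using s \<tau>' K by (auto simp: \<tau>_def)
  then have \<tau>K: "\<tau> * K \<le> 1 / 100" using K by (simp add: field_simps)
  define t where "t n = \<tau> / 100 ^ n" for n :: nat
  have t: "0 < t n" "t n \<le> \<tau>" for n
    using \<tau>(1) by (auto simp: t_def divide_le_eq)
  have "\<exists>q. block_map q = t n *\<^sub>R block_deriv ?v \<and> norm (q - t n *\<^sub>R ?v) \<le> s * t n" for n
    using t[of n] \<tau> by (intro sol) auto
  then obtain Q where Q: "\<And>n. block_map (Q n) = t n *\<^sub>R block_deriv ?v" "\<And>n. norm (Q n - t n *\<^sub>R ?v) \<le> s * t n"
    by metis
  have Q0: "block_map (Q n) = (0, 0, 0, (0, 0, t n))" for n
    unfolding Q(1) block_deriv_dir by (simp add: zero_prod_def)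
  have M: "\<bar>on_tile tile_moment (Q n) i - tile_moment 0 0 0 - t n * moment_rate i\<bar> \<le> t n" if "i < 6" for n i
    using mom[OF that t(1) _ Q(2)] t(2)[of n] \<tau>(2) by simp
  have lt: False
    if ij: "i < 6" "j < 6" and eq: "on_tile tile_moment (Q n) i = on_tile tile_moment (Q m) j" and nm: "n < m" for n m i j
  proof -
    obtain k where k: "m = Suc n + k" using nm less_iff_Suc_add by auto
    have "t m = t n / (100 * 100 ^ k)" by (simp add: t_def k power_add)
    also have "\<dots> \<le> t n / 100" using t(1)[of n] by (intro divide_left_mono) auto
    finally have tm: "t m \<le> t n / 100" .
    \<comment> \<open>The ratio 100 suffices: the moment at n deviates from the base value by at
      least 35 t n, the one at m by at most 937 t m <= 9.37 t n.\<close>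
    have "\<bar>t n * moment_rate i\<bar> \<ge> t n * 36" "\<bar>t m * moment_rate j\<bar> \<le> t m * 936"
      using moment_rate_bounds[OF ij(1)] moment_rate_bounds[OF ij(2)] t(1)[of n] t(1)[of m] by (auto simp: abs_mult)
    then show False
      using M[OF ij(1), of n] M[OF ij(2), of m] tm t(1)[of n] t(1)[of m] eq by linarith
  qed
  show ?thesis
  proof (rule that[of Q])
    show "small (block_offset (Q n) i)" for n i
    proof (rule small_block_offset)
      have "norm (Q n) \<le> norm (t n *\<^sub>R ?v) + norm (Q n - t n *\<^sub>R ?v)" by (rule norm_triangle_sub)
      also have "\<dots> \<le> t n * norm ?v + s * t n" using Q(2)[of n] t(1)[of n] by simp
      also have "\<dots> \<le> t n * K" using s t(1)[of n] by (simp add: K_def algebra_simps)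
      also have "\<dots> \<le> \<tau> * K" using t(2)[of n] K by simp
      finally show "norm (Q n) \<le> 1 / 100" using \<tau>K by linarith
    qed
    show "on_tile tile_perimeter (Q n) i = 56" "on_tile tile_area (Q n) i = 176" if "i < 6" for n i
      using block_map_solution[OF Q0 that] by auto
    show "n = m \<and> i = j" if ij: "i < 6" "j < 6" and eq: "on_tile tile_moment (Q n) i = on_tile tile_moment (Q m) j" for n m i j
    proof -
      have nm: "n = m" using lt[OF ij eq] lt[OF ij(2,1) eq[symmetric]] by (cases n m rule: linorder_cases) auto
      \<comment> \<open>Within one block two errors of size t n cannot bridge a gap of 36 t
        n.\<close>
      have "\<bar>t n * (moment_rate i - moment_rate j)\<bar> \<le> 2 * t n"
        using M[OF ij(1), of n] M[OF ij(2), of m] eq unfolding nm by (simp add: algebra_simps)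
      then have "\<bar>moment_rate i - moment_rate j\<bar> \<le> 2" using t(1)[of n] by (simp add: abs_mult)
      then have "i = j" using moment_rate_separated[OF ij] by force
      with nm show ?thesis by simp
    qed
  qed
qed

section \<open>Strips\<close>

text \<open>
  The half-planes cutting out a tile, in coordinates relative to its column and reflected so that the tile lies above
  the zigzag: \<open>wall\<close> is nonnegative to the right of a wall, \<open>fall\<close> and \<open>rise\<close> above a descending and an ascending
  zigzag edge.
\<close>

definition wall :: "offset \<Rightarrow> real \<Rightarrow> real \<Rightarrow> real" where
  "wall X u w = (8 - \<upsilon> X) * (u - 6 - \<phi> X) + (6 + \<phi> X - \<xi> X) * (11 - w)"

definition fall :: "offset \<Rightarrow> offset \<Rightarrow> real \<Rightarrow> real \<Rightarrow> real" where
  "fall X Y u w = (8 + \<xi> Y - \<xi> X) * (w - 3 - \<upsilon> X) + (6 + \<upsilon> X + \<upsilon> Y) * (u - \<xi> X)"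

definition rise :: "offset \<Rightarrow> offset \<Rightarrow> real \<Rightarrow> real \<Rightarrow> real" where
  "rise X Y u w = (8 + \<xi> Y - \<xi> X) * (w + 3 + \<upsilon> X) - (6 + \<upsilon> X + \<upsilon> Y) * (u - \<xi> X)"

definition in_tile :: "offset \<Rightarrow> offset \<Rightarrow> offset \<Rightarrow> real \<Rightarrow> real \<Rightarrow> bool" where
  "in_tile X Y Z u w \<longleftrightarrow> wall X u w \<ge> 0 \<and> fall X Y u w \<ge> 0 \<and> rise Y Z (u - 8) w \<ge> 0 \<and> wall Z (u - 16) w \<le> 0 \<and> w \<le> 11"

text \<open>Reflection in the centre line exchanges the two sides of the zigzag, so a point not
  above an edge is above the reflected edge, seen from the opposite row.\<close>

lemma rise_fall: "rise X Y u (- w) = - fall X Y u w"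
  by (simp add: rise_def fall_def algebra_simps)

text \<open>This and the next two lemmas rewrite a line from its other endpoint, so that signs can
  be read off from products of displacements.\<close>

lemma wall_alt: "wall X u w = (8 - \<upsilon> X) * (u - \<xi> X) - (6 + \<phi> X - \<xi> X) * (w - 3 - \<upsilon> X)"
  by (simp add: wall_def algebra_simps)

lemma fall_alt: "fall X Y u w = (8 + \<xi> Y - \<xi> X) * (w + 3 + \<upsilon> Y) + (6 + \<upsilon> X + \<upsilon> Y) * (u - 8 - \<xi> Y)"
  by (simp add: fall_def algebra_simps)

lemma rise_alt: "rise X Y u w = (8 + \<xi> Y - \<xi> X) * (w - 3 - \<upsilon> Y) - (6 + \<upsilon> X + \<upsilon> Y) * (u - 8 - \<xi> Y)"
  by (simp add: rise_def algebra_simps)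

lemma smallD:
  assumes "small X"
  shows "\<xi> X \<le> 1/100" "\<xi> X \<ge> -1/100" "\<upsilon> X \<le> 1/100" "\<upsilon> X \<ge> -1/100" "\<phi> X \<le> 1/100" "\<phi> X \<ge> -1/100"
  using assms unfolding small_def by linarith+

text \<open>The first of three covering cases. Between two consecutive zigzag vertices the position
  relative to the nearby edge and wall decides the tile; smallness of the offsets gives the
  remaining inequalities.\<close>

lemma in_tile_right_of_wall:
  assumes s: "small X" "small Y" "small Z"
    and u: "\<xi> X \<le> u" "u \<le> 8 + \<xi> Y" and w: "w \<le> 11" and f: "fall X Y u w \<ge> 0" and wl: "wall X u w \<ge> 0"
  shows "in_tile X Y Z u w"
proof -
  note b = smallD[OF s(1)] smallD[OF s(2)] smallD[OF s(3)]
  have "(6 + \<upsilon> X + \<upsilon> Y) * (u - 8 - \<xi> Y) \<le> 0"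
    using b u by (intro mult_nonneg_nonpos) linarith+
  then have "(8 + \<xi> Y - \<xi> X) * (w + 3 + \<upsilon> Y) \<ge> 0" using f unfolding fall_alt by linarith
  then have w3: "w + 3 + \<upsilon> Y \<ge> 0" using b by (simp add: zero_le_mult_iff)
  have "(8 + \<xi> Z - \<xi> Y) * (w + 3 + \<upsilon> Y) \<ge> 0" using b w3 by (intro mult_nonneg_nonneg) linarith+
  moreover have "(6 + \<upsilon> Y + \<upsilon> Z) * (u - 8 - \<xi> Y) \<le> 0"
    using b u by (intro mult_nonneg_nonpos) linarith+
  ultimately have r: "rise Y Z (u - 8) w \<ge> 0" unfolding rise_def by linarith
  \<comment> \<open>The far wall is out of reach: 7.99 * 13.98 exceeds 6.02 * 14.01.\<close>
  have "(8 - \<upsilon> Z) * (22 + \<phi> Z - u) \<ge> 799/100 * (1398/100)" using b u by (intro mult_mono) linarith+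
  moreover have "(6 + \<phi> Z - \<xi> Z) * (11 - w) \<le> 602/100 * (1401/100)" using b w w3 by (intro mult_mono) linarith+
  ultimately have "wall Z (u - 16) w \<le> 0" unfolding wall_def by (simp add: algebra_simps)
  with r f wl w show ?thesis by (simp add: in_tile_def)
qed

lemma in_tile_left_of_wall:
  assumes s: "small X" "small Y" "small Z"
    and u: "\<xi> Z \<le> u" and w: "w \<le> 11" and wl: "wall Z u w \<le> 0"
  shows "in_tile X Y Z (u + 16) w"
proof -
  note b = smallD[OF s(1)] smallD[OF s(2)] smallD[OF s(3)]
  define U where "U = u - \<xi> Z"
  define D where "D = w - 3 - \<upsilon> Z"
  have U: "U \<ge> 0" using u by (simp add: U_def)
  have UD: "(8 - \<upsilon> Z) * U \<le> (6 + \<phi> Z - \<xi> Z) * D" using wl unfolding wall_alt U_def D_def by linarith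
  have "(8 - \<upsilon> Z) * U \<ge> 0" using b U by (intro mult_nonneg_nonneg) linarith+
  have D: "D \<ge> 0"
  proof (rule ccontr)
    assume "\<not> D \<ge> 0"
    then have "(6 + \<phi> Z - \<xi> Z) * D < 0" using b by (intro mult_pos_neg) linarith+
    with UD \<open>(8 - \<upsilon> Z) * U \<ge> 0\<close> show False by linarith
  qed
  \<comment> \<open>Up to perturbation the wall gives 8 U <= 6 D and the rising edge requires 6 U <=
    8 D. Comparing every coefficient with 7 links the two.\<close>
  have "7 * U \<le> (8 - \<upsilon> Z) * U" "(6 + \<phi> Z - \<xi> Z) * D \<le> 7 * D" 
    "(8 + \<xi> Z - \<xi> Y) * D \<ge> 7 * D" "(6 + \<upsilon> Y + \<upsilon> Z) * U \<le> 7 * U"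
    using b U D by (intro mult_right_mono; linarith)+
  then have "(8 + \<xi> Z - \<xi> Y) * D - (6 + \<upsilon> Y + \<upsilon> Z) * U \<ge> 0" using UD by linarith
  then have r: "rise Y Z (u + 16 - 8) w \<ge> 0" unfolding rise_alt U_def D_def by simp
  have "(8 - \<upsilon> X) * (u + 10 - \<phi> X) \<ge> 0" using b u by (intro mult_nonneg_nonneg) linarith+
  moreover have "(6 + \<phi> X - \<xi> X) * (11 - w) \<ge> 0" using b w by (intro mult_nonneg_nonneg) linarith+
  ultimately have wX: "wall X (u + 16) w \<ge> 0" unfolding wall_def by (simp add: algebra_simps)
  have "(8 + \<xi> Y - \<xi> X) * (w - 3 - \<upsilon> X) \<ge> (8 + \<xi> Y - \<xi> X) * (- 1)"
    using b D unfolding D_def by (intro mult_left_mono) linarith+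
  moreover have "(8 + \<xi> Y - \<xi> X) * (- 1) = - (8 + \<xi> Y - \<xi> X)" by simp
  moreover have "- (8 + \<xi> Y - \<xi> X) \<ge> - 9" using b by linarith
  moreover have "(6 + \<upsilon> X + \<upsilon> Y) * (u + 16 - \<xi> X) \<ge> 5 * 15" using b u by (intro mult_mono) linarith+
  ultimately have "fall X Y (u + 16) w \<ge> 0" unfolding fall_def by linarith
  with r wX w wl show ?thesis by (simp add: in_tile_def)
qed

lemma in_tile_above_rise:
  assumes s: "small X" "small Y" "small Z"
    and u: "\<xi> Y \<le> u" "u \<le> 8 + \<xi> Z" and w: "w \<le> 11" and r: "rise Y Z u w \<ge> 0"
  shows "in_tile X Y Z (u + 8) w"
proof -
  note b = smallD[OF s(1)] smallD[OF s(2)] smallD[OF s(3)]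
  have "(6 + \<upsilon> Y + \<upsilon> Z) * (u - \<xi> Y) \<ge> 0" using b u by (intro mult_nonneg_nonneg) linarith+
  then have "(8 + \<xi> Z - \<xi> Y) * (w + 3 + \<upsilon> Y) \<ge> 0" using r unfolding rise_def by linarith
  then have w3: "w + 3 + \<upsilon> Y \<ge> 0" using b by (simp add: zero_le_mult_iff)
  have "(8 + \<xi> Y - \<xi> X) * (w + 3 + \<upsilon> Y) \<ge> 0" "(6 + \<upsilon> X + \<upsilon> Y) * (u - \<xi> Y) \<ge> 0"
    using b u w3 by (intro mult_nonneg_nonneg; linarith)+
  then have f: "fall X Y (u + 8) w \<ge> 0" unfolding fall_alt by simp
  have "(8 - \<upsilon> X) * (u + 8 - 6 - \<phi> X) \<ge> 0" "(6 + \<phi> X - \<xi> X) * (11 - w) \<ge> 0"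
    using b u w by (intro mult_nonneg_nonneg; linarith)+
  then have wX: "wall X (u + 8) w \<ge> 0" unfolding wall_def by (rule add_nonneg_nonneg)
  define U where "U = 8 + \<xi> Z - u"
  define D where "D = w - 3 - \<upsilon> Z"
  have U: "U \<ge> 0" using u by (simp add: U_def)
  have rD: "(8 + \<xi> Z - \<xi> Y) * D + (6 + \<upsilon> Y + \<upsilon> Z) * U \<ge> 0"
    using r unfolding rise_alt U_def D_def by (simp add: algebra_simps)
  have "(8 - \<upsilon> Z) * U + (6 + \<phi> Z - \<xi> Z) * D \<ge> 0"
  proof (cases "D \<ge> 0")
    case True
    have "(8 - \<upsilon> Z) * U \<ge> 0" "(6 + \<phi> Z - \<xi> Z) * D \<ge> 0"
      using b U True by (intro mult_nonneg_nonneg; linarith)+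
    then show ?thesis by linarith
  next
    case False
    \<comment> \<open>For D < 0 the comparison with 7 gives 8 U + 6 D >= 7 U + 7 D >= 6 U + 8 D, up
      to perturbation.\<close>
    have "7 * U \<le> (8 - \<upsilon> Z) * U" "(6 + \<upsilon> Y + \<upsilon> Z) * U \<le> 7 * U"
      using b U by (intro mult_right_mono; linarith)+
    moreover have "(6 + \<phi> Z - \<xi> Z) * D \<ge> 7 * D" "(8 + \<xi> Z - \<xi> Y) * D \<le> 7 * D"
      using b False by (intro mult_right_mono_neg; linarith)+
    ultimately show ?thesis using rD by linarith
  qed
  then have "wall Z (u - 8) w \<le> 0" unfolding wall_alt U_def D_def by (simp add: algebra_simps)
  with r f wX w show ?thesis by (simp add: in_tile_def)
qed

section \<open>Tiles as pentagons in the plane\<close>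

definition pt :: "real \<Rightarrow> real \<Rightarrow> real^2" where "pt x y = vector [x, y]"

lemma pt_nth [simp]: "pt x y $ 1 = x" "pt x y $ 2 = y"
  by (simp_all add: pt_def)

lemma dist_pt: "dist (pt x y) (pt x' y') = sqrt ((x - x')\<^sup>2 + (y - y')\<^sup>2)"
  by (simp add: dist_vec_def L2_set_def sum_2 dist_real_def)

text \<open>The sign \<sigma> = -1 reflects in the centre line at height b, so lower tiles share the
  coordinates of upper ones.\<close>

definition corner :: "real \<Rightarrow> real \<Rightarrow> real \<Rightarrow> real \<times> real \<Rightarrow> real^2" where
  "corner a b \<sigma> p = pt (a + fst p) (b + \<sigma> * snd p)"

lemma orient_corner:
  "orient (corner a b \<sigma> p) (corner a b \<sigma> q) (corner a b \<sigma> r) =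
     \<sigma> * ((fst q - fst p) * (snd r - snd p) - (snd q - snd p) * (fst r - fst p))"
  by (simp add: orient_def corner_def algebra_simps)

lemma dist_corner:
  assumes "\<sigma>\<^sup>2 = 1"
  shows "dist (corner a b \<sigma> p) (corner a b \<sigma> q) = len (fst p - fst q) (snd p - snd q)"
proof -
  have "(\<sigma> * snd p - \<sigma> * snd q)\<^sup>2 = (snd p - snd q)\<^sup>2"
    using assms by (simp add: power_mult_distrib flip: right_diff_distrib)
  then show ?thesis by (simp add: corner_def dist_pt len_def)
qed

lemma corner_surj: "\<sigma>\<^sup>2 = 1 \<Longrightarrow> corner a b \<sigma> (p$1 - a, \<sigma> * (p$2 - b)) = p"
  by (simp add: corner_def vec_eq_iff forall_2 power2_eq_square algebra_simps flip: mult.assoc)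

text \<open>F marks feet of walls and Z zigzag vertices. The middle vertex is across the centre
  line, hence the negative height in \<open>Z1\<close>.\<close>

abbreviation F0 :: "offset \<Rightarrow> real \<times> real" where "F0 X \<equiv> (6 + \<phi> X, 11)"
abbreviation Z0 :: "offset \<Rightarrow> real \<times> real" where "Z0 X \<equiv> (\<xi> X, 3 + \<upsilon> X)"
abbreviation Z1 :: "offset \<Rightarrow> real \<times> real" where "Z1 Y \<equiv> (8 + \<xi> Y, - (3 + \<upsilon> Y))"
abbreviation Z2 :: "offset \<Rightarrow> real \<times> real" where "Z2 Z \<equiv> (16 + \<xi> Z, 3 + \<upsilon> Z)"
abbreviation F2 :: "offset \<Rightarrow> real \<times> real" where "F2 Z \<equiv> (22 + \<phi> Z, 11)"

definition tile :: "real \<Rightarrow> real \<Rightarrow> real \<Rightarrow> offset \<Rightarrow> offset \<Rightarrow> offset \<Rightarrow> (real^2) set" where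
  "tile a b \<sigma> X Y Z = convex hull (corner a b \<sigma> ` {F0 X, Z0 X, Z1 Y, Z2 Z, F2 Z})"

text \<open>Differences of corner coordinates move by at most 1/50 from integers of size at most 22,
  so a product moves by at most 0.8804. A determinant of at least 2 thus stays positive.\<close>

lemma product_perturb:
  fixes p q :: real
  assumes "\<bar>p - p0\<bar> \<le> 1/50" "\<bar>q - q0\<bar> \<le> 1/50" "\<bar>p0\<bar> \<le> 22" "\<bar>q0\<bar> \<le> 22"
  shows "\<bar>p * q - p0 * q0\<bar> \<le> 9/10"
proof -
  have "p * q - p0 * q0 = (p - p0) * (q - q0) + p0 * (q - q0) + (p - p0) * q0" by (simp add: algebra_simps)
  moreover have "\<bar>(p - p0) * (q - q0)\<bar> \<le> 1/50 * (1/50)" "\<bar>p0 * (q - q0)\<bar> \<le> 22 * (1/50)" "\<bar>(p - p0) * q0\<bar> \<le> 1/50 * 22"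
    unfolding abs_mult using assms by (intro mult_mono; simp)+
  ultimately show ?thesis by linarith
qed

lemma det_perturb:
  fixes p q r s :: real
  assumes "\<bar>p - p0\<bar> \<le> 1/50" "\<bar>q - q0\<bar> \<le> 1/50" "\<bar>r - r0\<bar> \<le> 1/50" "\<bar>s - s0\<bar> \<le> 1/50"
    "\<bar>p0\<bar> \<le> 22" "\<bar>q0\<bar> \<le> 22" "\<bar>r0\<bar> \<le> 22" "\<bar>s0\<bar> \<le> 22" "p0 * q0 - r0 * s0 \<ge> 2"
  shows "p * q - r * s > 0"
  using product_perturb[OF assms(1,2,5,6)] product_perturb[OF assms(3,4,7,8)] assms(9) by linarith

text \<open>The ten determinants of the unperturbed pentagon are at least 2. The reflection reverses
  orientation, hence the reversed order for \<sigma> = -1.\<close>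

lemma tile_corners_ccw:
  assumes s: "small X" "small Y" "small Z"
  shows "\<sigma> = 1 \<Longrightarrow> ccw5 (corner a b \<sigma> (F0 X)) (corner a b \<sigma> (Z0 X)) (corner a b \<sigma> (Z1 Y)) (corner a b \<sigma> (Z2 Z)) (corner a b \<sigma> (F2 Z))"
    and "\<sigma> = -1 \<Longrightarrow> ccw5 (corner a b \<sigma> (F2 Z)) (corner a b \<sigma> (Z2 Z)) (corner a b \<sigma> (Z1 Y)) (corner a b \<sigma> (Z0 X)) (corner a b \<sigma> (F0 X))"
proof -
  note b = smallD[OF s(1)] smallD[OF s(2)] smallD[OF s(3)]
  define det :: "real \<times> real \<Rightarrow> real \<times> real \<Rightarrow> real \<times> real \<Rightarrow> real" where
    "det p q r = (fst q - fst p) * (snd r - snd p) - (snd q - snd p) * (fst r - fst p)" for p q r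
  have diff: "\<bar>(u - v) - (x - y)\<bar> \<le> 1/50" if "\<bar>u - x\<bar> \<le> 1/100" "\<bar>v - y\<bar> \<le> 1/100" for u v x y :: real
    using that by linarith
  have near: "det p q r > 0"
    if "\<bar>fst p - x1\<bar> \<le> 1/100" "\<bar>snd p - y1\<bar> \<le> 1/100" "\<bar>fst q - x2\<bar> \<le> 1/100" "\<bar>snd q - y2\<bar> \<le> 1/100"
      "\<bar>fst r - x3\<bar> \<le> 1/100" "\<bar>snd r - y3\<bar> \<le> 1/100" "\<bar>x2 - x1\<bar> \<le> 22" "\<bar>y3 - y1\<bar> \<le> 22" "\<bar>y2 - y1\<bar> \<le> 22" "\<bar>x3 - x1\<bar> \<le> 22"
      "(x2 - x1) * (y3 - y1) - (y2 - y1) * (x3 - x1) \<ge> 2" for p q r :: "real \<times> real" and x1 y1 x2 y2 x3 y3 :: real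
    unfolding det_def by (rule det_perturb[OF diff[OF that(3,1)] diff[OF that(6,2)] diff[OF that(4,2)] diff[OF that(5,1)] that(7-11)])
  have c: "\<bar>fst (F0 X) - 6\<bar> \<le> 1/100" "\<bar>snd (F0 X) - 11\<bar> \<le> 1/100" "\<bar>fst (Z0 X) - 0\<bar> \<le> 1/100" "\<bar>snd (Z0 X) - 3\<bar> \<le> 1/100"
    "\<bar>fst (Z1 Y) - 8\<bar> \<le> 1/100" "\<bar>snd (Z1 Y) - (-3)\<bar> \<le> 1/100" "\<bar>fst (Z2 Z) - 16\<bar> \<le> 1/100" "\<bar>snd (Z2 Z) - 3\<bar> \<le> 1/100"
    "\<bar>fst (F2 Z) - 22\<bar> \<le> 1/100" "\<bar>snd (F2 Z) - 11\<bar> \<le> 1/100"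
    unfolding fst_conv snd_conv abs_le_iff using b by linarith+
  have "det (F0 X) (Z0 X) (Z1 Y) > 0" by (rule near[OF c(1) c(2) c(3) c(4) c(5) c(6)]) simp_all
  moreover have "det (F0 X) (Z0 X) (Z2 Z) > 0" by (rule near[OF c(1) c(2) c(3) c(4) c(7) c(8)]) simp_all
  moreover have "det (F0 X) (Z0 X) (F2 Z) > 0" by (rule near[OF c(1) c(2) c(3) c(4) c(9) c(10)]) simp_all
  moreover have "det (F0 X) (Z1 Y) (Z2 Z) > 0" by (rule near[OF c(1) c(2) c(5) c(6) c(7) c(8)]) simp_all
  moreover have "det (F0 X) (Z1 Y) (F2 Z) > 0" by (rule near[OF c(1) c(2) c(5) c(6) c(9) c(10)]) simp_all
  moreover have "det (F0 X) (Z2 Z) (F2 Z) > 0" by (rule near[OF c(1) c(2) c(7) c(8) c(9) c(10)]) simp_all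
  moreover have "det (Z0 X) (Z1 Y) (Z2 Z) > 0" by (rule near[OF c(3) c(4) c(5) c(6) c(7) c(8)]) simp_all
  moreover have "det (Z0 X) (Z1 Y) (F2 Z) > 0" by (rule near[OF c(3) c(4) c(5) c(6) c(9) c(10)]) simp_all
  moreover have "det (Z0 X) (Z2 Z) (F2 Z) > 0" by (rule near[OF c(3) c(4) c(7) c(8) c(9) c(10)]) simp_all
  moreover have "det (Z1 Y) (Z2 Z) (F2 Z) > 0" by (rule near[OF c(5) c(6) c(7) c(8) c(9) c(10)]) simp_all
  ultimately have D: "det (F0 X) (Z0 X) (Z1 Y) > 0" "det (F0 X) (Z0 X) (Z2 Z) > 0" "det (F0 X) (Z0 X) (F2 Z) > 0"
    "det (F0 X) (Z1 Y) (Z2 Z) > 0" "det (F0 X) (Z1 Y) (F2 Z) > 0" "det (F0 X) (Z2 Z) (F2 Z) > 0"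
    "det (Z0 X) (Z1 Y) (Z2 Z) > 0" "det (Z0 X) (Z1 Y) (F2 Z) > 0" "det (Z0 X) (Z2 Z) (F2 Z) > 0"
    "det (Z1 Y) (Z2 Z) (F2 Z) > 0" by blast+
  have rev: "- 1 * det r q p = det p q r" for p q r by (simp add: det_def algebra_simps)
  show "\<sigma> = 1 \<Longrightarrow> ccw5 (corner a b \<sigma> (F0 X)) (corner a b \<sigma> (Z0 X)) (corner a b \<sigma> (Z1 Y)) (corner a b \<sigma> (Z2 Z)) (corner a b \<sigma> (F2 Z))"
    unfolding ccw5_def orient_corner using D unfolding det_def by simp
  show "\<sigma> = -1 \<Longrightarrow> ccw5 (corner a b \<sigma> (F2 Z)) (corner a b \<sigma> (Z2 Z)) (corner a b \<sigma> (Z1 Y)) (corner a b \<sigma> (Z0 X)) (corner a b \<sigma> (F0 X))"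
    unfolding ccw5_def orient_corner det_def[symmetric] by (simp only: rev D)
qed

context
  fixes X Y Z :: offset and \<sigma> a b :: real
  assumes small: "small X" "small Y" "small Z" and \<sigma>: "\<sigma> = 1 \<or> \<sigma> = -1"
begin

lemma sigma_square: "\<sigma>\<^sup>2 = 1" using \<sigma> by auto

lemma tile_hull:
  "tile a b \<sigma> X Y Z = convex hull {corner a b \<sigma> (F0 X), corner a b \<sigma> (Z0 X), corner a b \<sigma> (Z1 Y), corner a b \<sigma> (Z2 Z), corner a b \<sigma> (F2 Z)}"
  "tile a b \<sigma> X Y Z = convex hull {corner a b \<sigma> (F2 Z), corner a b \<sigma> (Z2 Z), corner a b \<sigma> (Z1 Y), corner a b \<sigma> (Z0 X), corner a b \<sigma> (F0 X)}"
  unfolding tile_def by (simp_all add: insert_commute)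

lemma tile_halfplanes:
  "p \<in> tile a b \<sigma> X Y Z \<longleftrightarrow>
    \<sigma> * orient (corner a b \<sigma> (F0 X)) (corner a b \<sigma> (Z0 X)) p \<ge> 0 \<and>
    \<sigma> * orient (corner a b \<sigma> (Z0 X)) (corner a b \<sigma> (Z1 Y)) p \<ge> 0 \<and>
    \<sigma> * orient (corner a b \<sigma> (Z1 Y)) (corner a b \<sigma> (Z2 Z)) p \<ge> 0 \<and>
    \<sigma> * orient (corner a b \<sigma> (Z2 Z)) (corner a b \<sigma> (F2 Z)) p \<ge> 0 \<and>
    \<sigma> * orient (corner a b \<sigma> (F2 Z)) (corner a b \<sigma> (F0 X)) p \<ge> 0"
  using \<sigma>
proof
  assume 1: "\<sigma> = 1"
  show ?thesis unfolding tile_hull(1) pentagon_halfplanes[OF tile_corners_ccw(1)[OF small 1]] using 1 by simp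
next
  assume 1: "\<sigma> = -1"
  have m: "- 1 * orient A B p = orient B A p" for A B by (simp add: orient_swap[of A B])
  show ?thesis unfolding tile_hull(2) pentagon_halfplanes[OF tile_corners_ccw(2)[OF small 1]]
    unfolding 1 m by blast
qed

lemma corner_in_tile_iff: "corner a b \<sigma> (u, w) \<in> tile a b \<sigma> X Y Z \<longleftrightarrow> in_tile X Y Z u w"
proof -
  have *: "\<sigma> * (\<sigma> * x) = x" for x using sigma_square by (simp add: power2_eq_square flip: mult.assoc)
  have top: "((6 + \<phi> X) - (22 + \<phi> Z)) * (w - 11) \<ge> 0 \<longleftrightarrow> w \<le> 11"
    using smallD[OF small(1)] smallD[OF small(3)] by (auto simp: zero_le_mult_iff)
  show ?thesis
    unfolding tile_halfplanes orient_corner * in_tile_def wall_def fall_def rise_def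
    using top by (auto simp: algebra_simps)
qed

lemma in_tileI: "in_tile X Y Z (p$1 - a) (\<sigma> * (p$2 - b)) \<Longrightarrow> p \<in> tile a b \<sigma> X Y Z"
  using corner_in_tile_iff[of "p$1 - a" "\<sigma> * (p$2 - b)"] unfolding corner_surj[OF sigma_square] by simp

lemma tile_pentagon: "convex_pentagon (tile a b \<sigma> X Y Z)"
  using \<sigma> pentagon_convex_pentagon[OF tile_corners_ccw(1)[OF small]] pentagon_convex_pentagon[OF tile_corners_ccw(2)[OF small]]
    tile_hull by metis

lemma perimeter_tile: "perimeter (tile a b \<sigma> X Y Z) = tile_perimeter X Y Z"
proof -
  have d: "dist (corner a b \<sigma> (F0 X)) (corner a b \<sigma> (Z0 X)) = len (6 + \<phi> X - \<xi> X) (8 - \<upsilon> X)"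
    "dist (corner a b \<sigma> (Z0 X)) (corner a b \<sigma> (Z1 Y)) = len (8 + \<xi> Y - \<xi> X) (6 + \<upsilon> X + \<upsilon> Y)"
    "dist (corner a b \<sigma> (Z1 Y)) (corner a b \<sigma> (Z2 Z)) = len (8 + \<xi> Z - \<xi> Y) (6 + \<upsilon> Y + \<upsilon> Z)"
    "dist (corner a b \<sigma> (Z2 Z)) (corner a b \<sigma> (F2 Z)) = len (6 + \<phi> Z - \<xi> Z) (8 - \<upsilon> Z)"
    unfolding dist_corner[OF sigma_square] len_def by (simp_all add: power2_eq_square algebra_simps)
  have t: "dist (corner a b \<sigma> (F2 Z)) (corner a b \<sigma> (F0 X)) = 16 + \<phi> Z - \<phi> X"
    unfolding dist_corner[OF sigma_square] len_def using smallD[OF small(1)] smallD[OF small(3)] by simp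
  show ?thesis
    using \<sigma>
  proof
    assume 1: "\<sigma> = 1"
    show ?thesis
      unfolding tile_hull(1) pentagon_perimeter[OF tile_corners_ccw(1)[OF small 1]] tile_perimeter_def d t by simp
  next
    assume 1: "\<sigma> = -1"
    show ?thesis
      unfolding tile_hull(2) pentagon_perimeter[OF tile_corners_ccw(2)[OF small 1]] tile_perimeter_def
      using d t by (simp add: dist_commute)
  qed
qed

lemma area_tile: "area (tile a b \<sigma> X Y Z) = tile_area X Y Z"
  using \<sigma>
proof
  assume 1: "\<sigma> = 1"
  show ?thesis
    unfolding tile_hull(1) pentagon_area[OF tile_corners_ccw(1)[OF small 1]] orient_corner tile_area_def
    using 1 by (simp add: field_simps)
next
  assume 1: "\<sigma> = -1"
  show ?thesis
    unfolding tile_hull(2) pentagon_area[OF tile_corners_ccw(2)[OF small 1]] orient_corner tile_area_def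
    using 1 by (simp add: field_simps)
qed

lemma tile_box: "tile a b \<sigma> X Y Z \<subseteq> cbox (pt (a - 1) (b - 11)) (pt (a + 23) (b + 11))"
  unfolding tile_def
proof (rule hull_minimal)
  have "corner a b \<sigma> (u, w) \<in> cbox (pt (a - 1) (b - 11)) (pt (a + 23) (b + 11))"
    if "- 1 \<le> u" "u \<le> 23" "- 11 \<le> w" "w \<le> 11" for u w
    using that \<sigma> by (auto simp: mem_box_cart forall_2 corner_def)
  then show "corner a b \<sigma> ` {F0 X, Z0 X, Z1 Y, Z2 Z, F2 Z} \<subseteq> cbox (pt (a - 1) (b - 11)) (pt (a + 23) (b + 11))"
    using smallD[OF small(1)] smallD[OF small(2)] smallD[OF small(3)] by auto
qed (rule convex_box)

text \<open>The list form, with distinctness, allows the double sum in \<open>moment\<close> to be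
  expanded term by term.\<close>

lemma tile_vertices:
  "vertices (tile a b \<sigma> X Y Z) = set [corner a b \<sigma> (F0 X), corner a b \<sigma> (Z0 X), corner a b \<sigma> (Z1 Y), corner a b \<sigma> (Z2 Z), corner a b \<sigma> (F2 Z)]"
  and tile_corners_distinct:
  "distinct [corner a b \<sigma> (F0 X), corner a b \<sigma> (Z0 X), corner a b \<sigma> (Z1 Y), corner a b \<sigma> (Z2 Z), corner a b \<sigma> (F2 Z)]"
proof -
  have "vertices (tile a b \<sigma> X Y Z) = {corner a b \<sigma> (F0 X), corner a b \<sigma> (Z0 X), corner a b \<sigma> (Z1 Y), corner a b \<sigma> (Z2 Z), corner a b \<sigma> (F2 Z)}"
    using \<sigma>
  proof
    assume 1: "\<sigma> = 1"
    show ?thesis unfolding tile_hull(1) pentagon_vertices[OF tile_corners_ccw(1)[OF small 1]] ..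
  next
    assume 1: "\<sigma> = -1"
    show ?thesis unfolding tile_hull(2) pentagon_vertices[OF tile_corners_ccw(2)[OF small 1]] by blast
  qed
  then show "vertices (tile a b \<sigma> X Y Z) = set [corner a b \<sigma> (F0 X), corner a b \<sigma> (Z0 X), corner a b \<sigma> (Z1 Y), corner a b \<sigma> (Z2 Z), corner a b \<sigma> (F2 Z)]"
    by simp
  show "distinct [corner a b \<sigma> (F0 X), corner a b \<sigma> (Z0 X), corner a b \<sigma> (Z1 Y), corner a b \<sigma> (Z2 Z), corner a b \<sigma> (F2 Z)]"
    using \<sigma> ccw5_distinct[OF tile_corners_ccw(1)[OF small]] ccw5_distinct[OF tile_corners_ccw(2)[OF small]]
    by (metis distinct_rev rev.simps append.simps)
qed

end

section \<open>Invariance under isometries\<close>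

text \<open>A congruence invariant that is polynomial in the corners.\<close>

definition moment :: "(real^2) set \<Rightarrow> real" where
  "moment P = (\<Sum>p\<in>vertices P. \<Sum>q\<in>vertices P. (dist p q)\<^sup>2)"

lemma moment_tile:
  assumes s: "small X" "small Y" "small Z" and \<sigma>: "\<sigma> = 1 \<or> \<sigma> = -1"
  shows "moment (tile a b \<sigma> X Y Z) = 2 * tile_moment X Y Z"
proof -
  have d: "(dist (corner a b \<sigma> p) (corner a b \<sigma> q))\<^sup>2 = (fst p - fst q)\<^sup>2 + (snd p - snd q)\<^sup>2" for p q
  proof -
    have "\<sigma>\<^sup>2 = 1" using \<sigma> by auto
    then show ?thesis by (simp add: dist_corner len_def)
  qed
  show ?thesis
    unfolding moment_def tile_vertices[OF s \<sigma>] sum.distinct_set_conv_list[OF tile_corners_distinct[OF s \<sigma>]]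
      list.map sum_list.Cons sum_list.Nil d tile_moment_def fst_conv snd_conv
    by (simp add: power2_eq_square algebra_simps)
qed

text \<open>Membership in a segment is equality in the triangle inequality, hence metric. Extreme
  points are defined by open segments, so isometries preserve them.\<close>

lemma isometry_open_segment:
  fixes f :: "'a::euclidean_space \<Rightarrow> 'a"
  assumes "\<And>x y. dist (f x) (f y) = dist x y"
  shows "f x \<in> open_segment (f a) (f b) \<longleftrightarrow> x \<in> open_segment a b"
proof -
  have "f u = f v \<longleftrightarrow> u = v" for u v using assms[of u v] by (metis dist_eq_0_iff)
  moreover have "u \<in> closed_segment v w \<longleftrightarrow> dist v w = dist v u + dist u w" for u v w :: 'a
    by (metis between between_mem_segment)
  ultimately show ?thesis
    unfolding open_segment_def by (simp add: assms)
qed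

lemma isometry_vertices:
  assumes "\<And>x y. dist (f x) (f y) = dist x y"
  shows "vertices (f ` P) = f ` vertices P"
proof -
  have "f u = f v \<longleftrightarrow> u = v" for u v using assms[of u v] by (metis dist_eq_0_iff)
  then show ?thesis
    unfolding vertices_def extreme_point_of_def by (auto simp: isometry_open_segment[of f, OF assms])
qed

lemma moment_congruent: "congruent_sets P Q \<Longrightarrow> moment P = moment Q"
proof -
  assume "congruent_sets P Q"
  then obtain f :: "real^2 \<Rightarrow> real^2" where f: "\<And>x y. dist (f x) (f y) = dist x y" "Q = f ` P"
    unfolding congruent_sets_def by blast
  have i: "inj_on f A" for A using f(1) by (metis dist_eq_0_iff inj_onI)
  show ?thesis
    unfolding moment_def f(2) isometry_vertices[of f, OF f(1)] by (simp add: sum.reindex[OF i] f(1))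
qed

section \<open>Disjointness of interiors\<close>

lemma separated_interiors_signed:
  assumes "A \<noteq> B" "\<sigma> = 1 \<or> \<sigma> = -1" "\<And>p. p \<in> P \<Longrightarrow> \<sigma> * orient A B p \<ge> 0" "\<And>p. p \<in> Q \<Longrightarrow> - \<sigma> * orient A B p \<ge> 0"
  shows "interior P \<inter> interior Q = {}"
  using assms(2)
proof
  assume "\<sigma> = 1"
  then show ?thesis using assms(3,4) orient_swap[of B A]
    by (intro separated_interiors[OF assms(1)]) force+
next
  assume "\<sigma> = -1"
  then show ?thesis using assms(3,4) orient_swap[of B A]
    by (intro separated_interiors[OF assms(1)[symmetric]]) force+
qed

text \<open>Successive tiles lie on opposite sides of a common zigzag edge: the rising edge of the
  first is the falling edge of the second after reflection.\<close>

lemma tile_disjoint_opposite: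
  assumes s: "small X" "small Y" "small Z" "small W" and \<sigma>: "\<sigma> = 1 \<or> \<sigma> = -1"
  shows "interior (tile a b \<sigma> X Y Z) \<inter> interior (tile (a + 8) b (- \<sigma>) Y Z W) = {}"
proof (rule separated_interiors_signed[OF _ \<sigma>])
  show "corner a b \<sigma> (Z1 Y) \<noteq> corner a b \<sigma> (Z2 Z)"
    using tile_corners_distinct[OF s(1-3) \<sigma>] by auto
  show "\<sigma> * orient (corner a b \<sigma> (Z1 Y)) (corner a b \<sigma> (Z2 Z)) p \<ge> 0" if "p \<in> tile a b \<sigma> X Y Z" for p
    using that tile_halfplanes[OF s(1-3) \<sigma>] by blast
  have e: "corner (a + 8) b (- \<sigma>) (Z0 Y) = corner a b \<sigma> (Z1 Y)" "corner (a + 8) b (- \<sigma>) (Z1 Z) = corner a b \<sigma> (Z2 Z)"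
    by (simp_all add: corner_def vec_eq_iff forall_2 algebra_simps)
  have \<sigma>': "- \<sigma> = 1 \<or> - \<sigma> = -1" using \<sigma> by auto
  show "- \<sigma> * orient (corner a b \<sigma> (Z1 Y)) (corner a b \<sigma> (Z2 Z)) p \<ge> 0" if "p \<in> tile (a + 8) b (- \<sigma>) Y Z W" for p
    using that tile_halfplanes[OF s(2-4) \<sigma>', where p = p and a = "a + 8" and b = b] unfolding e by blast
qed

text \<open>Consecutive tiles of one row are separated by their common wall.\<close>

lemma tile_disjoint_same_side:
  assumes s: "small X" "small Y" "small Z" "small V" "small W" and \<sigma>: "\<sigma> = 1 \<or> \<sigma> = -1"
  shows "interior (tile a b \<sigma> X Y Z) \<inter> interior (tile (a + 16) b \<sigma> Z V W) = {}"
proof (rule separated_interiors_signed[OF _ \<sigma>])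
  show "corner a b \<sigma> (Z2 Z) \<noteq> corner a b \<sigma> (F2 Z)"
    using tile_corners_distinct[OF s(1-3) \<sigma>] by auto
  show "\<sigma> * orient (corner a b \<sigma> (Z2 Z)) (corner a b \<sigma> (F2 Z)) p \<ge> 0" if "p \<in> tile a b \<sigma> X Y Z" for p
    using that tile_halfplanes[OF s(1-3) \<sigma>] by blast
  have e: "corner (a + 16) b \<sigma> (Z0 Z) = corner a b \<sigma> (Z2 Z)" "corner (a + 16) b \<sigma> (F0 Z) = corner a b \<sigma> (F2 Z)"
    by (simp_all add: corner_def vec_eq_iff forall_2)
  show "- \<sigma> * orient (corner a b \<sigma> (Z2 Z)) (corner a b \<sigma> (F2 Z)) p \<ge> 0" if "p \<in> tile (a + 16) b \<sigma> Z V W" for p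
  proof -
    have "\<sigma> * orient (corner a b \<sigma> (F2 Z)) (corner a b \<sigma> (Z2 Z)) p \<ge> 0"
      using that tile_halfplanes[OF s(3-5) \<sigma>, where p = p and a = "a + 16" and b = b] unfolding e by blast
    then show ?thesis by (simp add: orient_swap[of "corner a b \<sigma> (F2 Z)"])
  qed
qed

lemma interior_disjoint_boxes:
  fixes P Q :: "(real^2) set"
  assumes "P \<subseteq> cbox (pt l1 l2) (pt u1 u2)" "Q \<subseteq> cbox (pt l1' l2') (pt u1' u2')" "u1 \<le> l1' \<or> u2 \<le> l2'"
  shows "interior P \<inter> interior Q = {}"
proof -
  have "interior P \<subseteq> box (pt l1 l2) (pt u1 u2)" "interior Q \<subseteq> box (pt l1' l2') (pt u1' u2')"
    using interior_mono[OF assms(1)] interior_mono[OF assms(2)] by (simp_all add: interior_cbox)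
  moreover have "box (pt l1 l2) (pt u1 u2) \<inter> box (pt l1' l2') (pt u1' u2') = {}"
    using assms(3) by (force simp: mem_box_cart forall_2)
  ultimately show ?thesis by blast
qed

section \<open>Assembling the strips into a tiling\<close>

definition side :: "int \<Rightarrow> real" where "side j = (if even j then 1 else - 1)"

lemma side_cases: "side j = 1 \<or> side j = - 1" by (simp add: side_def)

lemma side_shift: "side (j + 1) = - side j" "side (j + 2) = side j" "side (j - 1) = - side j" "side (j - 2) = side j"
    "side (1 + j) = - side j"
  by (simp_all add: side_def)

context
  fixes off :: "int \<Rightarrow> int \<Rightarrow> offset"
  assumes off: "\<And>k j. small (off k j)"
begin

definition strip_tile :: "int \<Rightarrow> int \<Rightarrow> (real^2) set" where
  "strip_tile k j = tile (8 * of_int j) (22 * of_int k) (side j) (off k j) (off k (j + 1)) (off k (j + 2))"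

lemma strip_tileI:
  "in_tile (off k j) (off k (j + 1)) (off k (j + 2)) (p$1 - 8 * of_int j) (side j * (p$2 - 22 * of_int k)) \<Longrightarrow> p \<in> strip_tile k j"
  unfolding strip_tile_def by (rule in_tileI[OF off off off side_cases])

text \<open>Vertex n is within 1/100 of 8 n horizontally, so the floor of x / 8 is off by at most
  one.\<close>

lemma zigzag_step:
  obtains m :: int where "\<xi> (off k m) \<le> x - 8 * of_int m" "x - 8 * of_int m \<le> 8 + \<xi> (off k (m + 1))"
proof -
  define n where "n = \<lfloor>x / 8\<rfloor>"
  have n: "8 * of_int n \<le> x" "x < 8 * of_int n + 8" unfolding n_def by linarith+
  note b = smallD[OF off]
  show ?thesis
  proof (cases "x < 8 * of_int n + \<xi> (off k n)")
    case True
    then show ?thesis using n b(1)[of k "n - 1"] by (intro that[of "n - 1"]) simp_all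
  next
    case False
    show ?thesis
    proof (cases "x \<le> 8 * of_int n + 8 + \<xi> (off k (n + 1))")
      case True
      then show ?thesis using False by (intro that[of n]) simp_all
    next
      case F2: False
      then show ?thesis using n b(2)[of k "n + 1 + 1"] by (intro that[of "n + 1"]) simp_all
    qed
  qed
qed

text \<open>Let the point lie between vertices m and m + 1. Across the zigzag edge it is in tile m -
  1; otherwise the wall at vertex m decides between tile m and tile m - 2.\<close>

lemma strip_tiles_cover: "\<exists>k j. p \<in> strip_tile k j"
proof -
  define k where "k = \<lfloor>(p$2 + 11) / 22\<rfloor>"
  have k: "22 * of_int k - 11 \<le> p$2" "p$2 \<le> 22 * of_int k + 11"
    using floor_correct[of "(p$2 + 11) / 22"] by (auto simp: k_def field_simps)
  obtain m where m: "\<xi> (off k m) \<le> p$1 - 8 * of_int m" "p$1 - 8 * of_int m \<le> 8 + \<xi> (off k (m + 1))"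
    by (rule zigzag_step)
  define u where "u = p$1 - 8 * of_int m"
  define w where "w = side m * (p$2 - 22 * of_int k)"
  have w: "w \<le> 11" "- w \<le> 11" using k side_cases[of m] by (auto simp: w_def)
  have u: "\<xi> (off k m) \<le> u" "u \<le> 8 + \<xi> (off k (m + 1))" using m by (simp_all add: u_def)
  show ?thesis
  proof (cases "fall (off k m) (off k (m + 1)) u w \<ge> 0")
    case True
    show ?thesis
    proof (cases "wall (off k m) u w \<ge> 0")
      case True
      then have "in_tile (off k m) (off k (m + 1)) (off k (m + 2)) u w"
        using u w \<open>fall _ _ u w \<ge> 0\<close> by (intro in_tile_right_of_wall off)
      then show ?thesis using strip_tileI[of k m p] unfolding u_def w_def by blast
    next
      case False
      then have "in_tile (off k (m - 2)) (off k (m - 2 + 1)) (off k (m - 2 + 2)) (u + 16) w"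
        using u w by (intro in_tile_left_of_wall off) simp_all
      then show ?thesis using strip_tileI[of k "m - 2" p] unfolding u_def w_def side_shift
        by (auto simp: algebra_simps)
    qed
  next
    case False
    have m: "m - 1 + 1 = m" "m - 1 + 2 = m + 1" by simp_all
    have "in_tile (off k (m - 1)) (off k (m - 1 + 1)) (off k (m - 1 + 2)) (u + 8) (- w)"
      unfolding m using u w False by (intro in_tile_above_rise off) (simp_all add: rise_fall)
    then show ?thesis using strip_tileI[of k "m - 1" p] unfolding u_def w_def side_shift
      by (auto simp: algebra_simps)
  qed
qed

lemma strip_tile_box:
  "strip_tile k j \<subseteq> cbox (pt (8 * of_int j - 1) (22 * of_int k - 11)) (pt (8 * of_int j + 23) (22 * of_int k + 11))"
  unfolding strip_tile_def by (rule tile_box[OF off off off side_cases])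

lemma strip_tiles_disjoint_aux:
  assumes "j < i" shows "interior (strip_tile k j) \<inter> interior (strip_tile k i) = {}"
proof -
  consider "i = j + 1" | "i = j + 2" | "i \<ge> j + 3" using assms by linarith
  then show ?thesis
  proof cases
    case 1
    then show ?thesis
      using tile_disjoint_opposite[OF off off off off side_cases, of "8 * of_int j" "22 * of_int k" j k j k "j + 1" k "j + 2" k "j + 3"]
      by (simp add: strip_tile_def side_shift algebra_simps)
  next
    case 2
    then show ?thesis
      using tile_disjoint_same_side[OF off off off off off side_cases, of "8 * of_int j" "22 * of_int k" j k j k "j + 1" k "j + 2" k "j + 3" k "j + 4"]
      by (simp add: strip_tile_def side_shift algebra_simps)
  next
    case 3
    \<comment> \<open>The box of tile j ends at 8 j + 23, exactly where that of tile j + 3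
      begins.\<close>
    then have "of_int i \<ge> of_int j + (3 :: real)" by linarith
    then show ?thesis by (intro interior_disjoint_boxes[OF strip_tile_box strip_tile_box]) simp
  qed
qed

lemma strip_tiles_disjoint:
  assumes "(k, j) \<noteq> (l, i)" shows "interior (strip_tile k j) \<inter> interior (strip_tile l i) = {}"
proof (cases k l rule: linorder_cases)
  case less
  then have "of_int l \<ge> of_int k + (1 :: real)" by linarith
  then show ?thesis by (intro interior_disjoint_boxes[OF strip_tile_box strip_tile_box]) simp
next
  case greater
  then have "of_int k \<ge> of_int l + (1 :: real)" by linarith
  then have "interior (strip_tile l i) \<inter> interior (strip_tile k j) = {}"
    by (intro interior_disjoint_boxes[OF strip_tile_box strip_tile_box]) simp
  then show ?thesis by blast
next
  case equal
  then show ?thesis using assms strip_tiles_disjoint_aux[of j i k] strip_tiles_disjoint_aux[of i j k]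
    by (cases j i rule: linorder_cases) auto
qed

lemma strip_tile_pentagon: "convex_pentagon (strip_tile k j)"
  unfolding strip_tile_def by (rule tile_pentagon[OF off off off side_cases])

lemma tiling_strip_tiles: "tiling (range (\<lambda>(k, j). strip_tile k j))"
  unfolding tiling_def
proof (intro conjI)
  show "\<forall>P\<in>range (\<lambda>(k, j). strip_tile k j). convex_polygon P"
    using strip_tile_pentagon by (auto simp: convex_pentagon_def)
  show "pairwise (\<lambda>P Q. interior P \<inter> interior Q = {}) (range (\<lambda>(k, j). strip_tile k j))"
  proof (rule pairwiseI)
    fix P Q assume "P \<in> range (\<lambda>(k, j). strip_tile k j)" "Q \<in> range (\<lambda>(k, j). strip_tile k j)" "P \<noteq> Q"
    then obtain k j l i where "P = strip_tile k j" "Q = strip_tile l i" "(k, j) \<noteq> (l, i)" by auto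
    then show "interior P \<inter> interior Q = {}" using strip_tiles_disjoint by simp
  qed
  show "\<Union> (range (\<lambda>(k, j). strip_tile k j)) = UNIV"
    using strip_tiles_cover by fast
qed

lemma strip_tile_values:
  "perimeter (strip_tile k j) = tile_perimeter (off k j) (off k (j + 1)) (off k (j + 2))"
  "area (strip_tile k j) = tile_area (off k j) (off k (j + 1)) (off k (j + 2))"
  "moment (strip_tile k j) = 2 * tile_moment (off k j) (off k (j + 1)) (off k (j + 2))"
  unfolding strip_tile_def
  by (simp_all only: perimeter_tile[OF off off off side_cases] area_tile[OF off off off side_cases] moment_tile[OF off off off side_cases])

end

section \<open>Gluing the blocks and conclusion\<close>

lemma block_offset_outside: "block_offset q 0 = 0" "block_offset q 1 = 0" "block_offset q 6 = 0" "block_offset q 7 = 0"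
  by (simp_all add: block_offset_def)

definition block_offsets :: "(int \<Rightarrow> int \<Rightarrow> block) \<Rightarrow> int \<Rightarrow> int \<Rightarrow> offset" where
  "block_offsets B k j = block_offset (B k (j div 6)) (nat (j mod 6))"

text \<open>Past the end of a block, the offsets 6 and 7 stand for the offsets 0 and 1 of the next
  block. All four are zero, so each tile depends on its own block only.\<close>

lemma block_offsets_shift:
  assumes "d = 1 \<or> d = 2"
  shows "block_offsets B k (j + int d) = block_offset (B k (j div 6)) (nat (j mod 6) + d)"
proof (cases "j mod 6 + int d < 6")
  case True
  have "0 \<le> j mod 6" by simp
  have e: "j + int d = j mod 6 + int d + 6 * (j div 6)" by simp
  have "(j + int d) div 6 = j div 6" "(j + int d) mod 6 = j mod 6 + int d"
    using True unfolding e by (simp_all only: div_mult_self2 mod_mult_self2) simp_all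
  then show ?thesis using \<open>0 \<le> j mod 6\<close> by (simp add: block_offsets_def nat_add_distrib)
next
  case False
  have "0 \<le> j mod 6" "j mod 6 < 6" by simp_all
  have "j + int d = j mod 6 + int d - 6 + 6 * (j div 6 + 1)" by simp
  then have "(j + int d) mod 6 = (j mod 6 + int d - 6) mod 6" by (metis mod_mult_self2)
  also have "\<dots> = j mod 6 + int d - 6" using False assms \<open>j mod 6 < 6\<close> by (intro mod_pos_pos_trivial) auto
  finally have "(j + int d) mod 6 = j mod 6 + int d - 6" .
  then have "nat ((j + int d) mod 6) = 0 \<or> nat ((j + int d) mod 6) = 1"
    using assms \<open>j mod 6 < 6\<close> by auto
  moreover have "nat (j mod 6) + d = 6 \<or> nat (j mod 6) + d = 7"
    using assms False \<open>j mod 6 < 6\<close> by auto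
  ultimately show ?thesis unfolding block_offsets_def using block_offset_outside by metis
qed

theorem theorem1:
  shows "\<exists>T :: (real^2) set set.
           tiling T \<and> fair T \<and>
           (\<forall>P\<in>T. convex_pentagon P) \<and>
           pairwise (\<lambda>P Q. \<not> congruent_sets P Q) T"
proof -
  obtain Q :: "nat \<Rightarrow> block" where Q: "\<And>n i. small (block_offset (Q n) i)"
    "\<And>n i. i < 6 \<Longrightarrow> on_tile tile_perimeter (Q n) i = 56"
    "\<And>n i. i < 6 \<Longrightarrow> on_tile tile_area (Q n) i = 176"
    "\<And>n m i j. i < 6 \<Longrightarrow> j < 6 \<Longrightarrow> on_tile tile_moment (Q n) i = on_tile tile_moment (Q m) j \<Longrightarrow> n = m \<and> i = j"
    using fair_blocks by blast
  \<comment> \<open>An injective numbering of the blocks of all strips, so that no two blocks share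
    a parameter.\<close>
  define B where "B k b = Q (to_nat (k, b))" for k b :: int
  define off where "off = block_offsets B"
  have small: "small (off k j)" for k j by (simp add: off_def block_offsets_def B_def Q)
  have lt: "nat (j mod 6) < 6" for j :: int by (simp add: nat_less_iff)
  have val: "f (off k j) (off k (j + 1)) (off k (j + 2)) = on_tile f (Q (to_nat (k, j div 6))) (nat (j mod 6))"
    for f :: "offset \<Rightarrow> offset \<Rightarrow> offset \<Rightarrow> real" and k j
    using block_offsets_shift[of 1 B k j] block_offsets_shift[of 2 B k j]
    by (simp add: off_def B_def block_offsets_def)
  let ?t = "strip_tile off"
  let ?T = "range (\<lambda>(k, j). ?t k j)"
  \<comment> \<open>The moment determines the block and the position in it, hence the tile.\<close>
  have inj: "(k, j) = (l, i)" if "moment (?t k j) = moment (?t l i)" for k j l i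
  proof -
    have "to_nat (k, j div 6) = to_nat (l, i div 6) \<and> nat (j mod 6) = nat (i mod 6)"
      using that unfolding strip_tile_values[OF small] val by (intro Q(4) lt) simp
    then have e: "k = l" "j div 6 = i div 6" "j mod 6 = i mod 6"
      by (auto simp: eq_nat_nat_iff)
    have "j = i" using e(2,3) by (metis div_mult_mod_eq)
    with e(1) show ?thesis by simp
  qed
  have "tiling ?T" by (rule tiling_strip_tiles[OF small])
  moreover have "perimeter (?t k j) = 56" "area (?t k j) = 176" for k j
    by (simp_all only: strip_tile_values[OF small] val Q(2,3)[OF lt])
  then have "fair ?T" unfolding fair_def by auto
  moreover have "\<forall>P\<in>?T. convex_pentagon P" using strip_tile_pentagon[OF small] by auto
  moreover have "pairwise (\<lambda>P Q. \<not> congruent_sets P Q) ?T"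
  proof (rule pairwiseI)
    fix P Q assume "P \<in> ?T" "Q \<in> ?T" "P \<noteq> Q"
    then obtain k j l i where "P = ?t k j" "Q = ?t l i" "(k, j) \<noteq> (l, i)" by auto
    then show "\<not> congruent_sets P Q" using inj moment_congruent by blast
  qed
  ultimately show ?thesis by blast
qed

end
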